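(* Let $G$ be a simple graph with $n$ vertices, let $\beta,\gamma$ be real numbers and $H(G)=\beta D(G)+\gamma A(G)$. Let $k$ be an integer. (i) For every vertex $v$ of $G$, \begin{eqnarray*} \Phi_k(H(G),x) &=& (x-\beta d(v))[\Phi_{k-1}(H_v(G)) + \Phi_k(H_v(G))] \\ && + \gamma^2 \sum_{u\in N(v)} [\Phi_{k-2}(H_{uv}(G)) - \Phi_k(H_{uv}(G))] \\ && +2 \sum_{C\in \mathfrak{C}_G(v)} \gamma^{|V(C)|}[(-1)^{|V(C)|}\Phi_{k-|V(C)|}(H_{V(C)}(G)) - \Phi_k(H_{V(C)}(G))]. \end{eqnarray*} (ii) For every edge $e=uv$ of $G$, \begin{eqnarray*} \Phi_k(H(G),x) &=& \Phi_k(H(G-e),x) - \beta[\Phi_k(H_v(G-e)) + \Phi_{k-1}(H_v(G-e))] \\ && - \beta[\Phi_k(H_u(G-e)) + \Phi_{k-1}(H_u(G-e))] \\ && + [(\beta^2 - \gamma^2)\Phi_k(H_{uv}(G)) + 2\beta^2 \Phi_{k-1}(H_{uv}(G)) + (\beta^2 + \gamma^2)\Phi_{k-2}(H_{uv}(G))] \\ && +2 \sum_{C\in \mathfrak{C}_G(e)} \gamma^{|V(C)|}[(-1)^{|V(C)|}\Phi_{k-|V(C)|}(H_{V(C)}(G)) - \Phi_k(H_{V(C)}(G))]. \end{eqnarray*}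
   Context: For an $m\times m$ matrix $M=(m_{ij})$ and an integer $j$ with $1\le j\le m$, the hook immanant is $d_j(M)=\sum_{\sigma\in S_m}\chi_{(j,1^{m-j})}(\sigma)\prod_{i=1}^m m_{i\sigma(i)}$, where $\chi_{(j,1^{m-j})}$ is the irreducible character of the symmetric group $S_m$ indexed by the hook partition $(j,1^{m-j})$; by convention $d_j(M)=0$ if $j<1$ or $j>m$. The hook immanantal polynomial is $\Phi_j(M,x)=d_j(xI_m-M)$, abbreviated $\Phi_j(M)$. For a simple graph $G$ with vertex set $\{v_1,\dots,v_n\}$, $D(G)=\mathrm{diag}(d(v_1),\dots,d(v_n))$ is the degree matrix and $A(G)$ the adjacency matrix; $H(G)=\beta D(G)+\gamma A(G)$. For $S\subseteq V(G)$, $H_S(G)$ is the principal submatrix of $H(G)$ obtained by deleting the rows and columns indexed by the vertices of $S$ (so its entries are entries of $H(G)$); $H_v(G)=H_{\{v\}}(G)$, $H_{uv}(G)=H_{\{u,v\}}(G)$. $N(v)$ is the set of neighbours of $v$, $d(v)$ its degree, $G-e$ the graph obtained by deleting edge $e$. $\mathfrak{C}_G(v)$ (resp. $\mathfrak{C}_G(e)$) is the set of cycles of $G$ containing the vertex $v$ (resp. the edge $e$), each cycle counted once as a subgraph; $|V(C)|$ is the number of vertices of $C$.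
   Formalization: For the empty (0×0) matrix, d_j is taken to be (-1)^j for j ≤ 0 and 0 for j > 0, instead of 0 for all j, since with 0 formula (i) fails (one vertex, k=1: x versus 0); the identities are stated for every real value of x. *)

theory Defs
  imports Complex_Main "HOL-Combinatorics.Permutations" "HOL-Library.Function_Algebras"
begin

section \<open>Traces on subspaces of a space of real functions\<close>

definition scale_fun :: "real \<Rightarrow> ('a \<Rightarrow> real) \<Rightarrow> 'a \<Rightarrow> real" where
  "scale_fun c f = (\<lambda>a. c * f a)"

interpretation fun_space: vector_space scale_fun
  by standard (auto simp: scale_fun_def fun_eq_iff algebra_simps)

text \<open>Intended for a finite-dimensional subspace \<open>W\<close> and a linear map \<open>f\<close> with
  \<open>f ` W \<subseteq> W\<close>; the value then does not depend on the chosen basis.\<close>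

definition trace_on :: "('a \<Rightarrow> real) set \<Rightarrow> (('a \<Rightarrow> real) \<Rightarrow> 'a \<Rightarrow> real) \<Rightarrow> real" where
  "trace_on W f =
     (let B = (SOME B. fun_space.independent B \<and> fun_space.span B = W)
      in \<Sum>b\<in>B. fun_space.representation B (f b) b)"


section \<open>Irreducible characters of the symmetric groups\<close>

text \<open>
  The irreducible character indexed by a partition \<open>p\<close> is the character of the Specht module
  of shape \<open>p\<close>. Everything is set up for the symmetric group on an arbitrary finite set \<open>I\<close>
  with \<open>card I = sum_list p\<close>. A partition is a list of positive parts in weakly decreasing
  order, and rows and columns of its diagram are numbered from 0.
\<close>

definition young_diagram :: "nat list \<Rightarrow> (nat \<times> nat) set" where
  "young_diagram p = {(r, c). r < length p \<and> c < p ! r}"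

definition tableaux :: "nat list \<Rightarrow> 'v set \<Rightarrow> (nat \<times> nat \<Rightarrow> 'v) set" where
  "tableaux p I = {t. bij_betw t (young_diagram p) I}"

definition tableau_column :: "nat list \<Rightarrow> (nat \<times> nat \<Rightarrow> 'v) \<Rightarrow> nat \<Rightarrow> 'v set" where
  "tableau_column p t c = {t (r, c) | r. (r, c) \<in> young_diagram p}"

text \<open>The tabloid of \<open>t\<close>, that is, its row-equivalence class, is given by its sequence of
  row sets.\<close>

definition tabloid :: "nat list \<Rightarrow> (nat \<times> nat \<Rightarrow> 'v) \<Rightarrow> nat \<Rightarrow> 'v set" where
  "tabloid p t = (\<lambda>r. {t (r, c) | c. (r, c) \<in> young_diagram p})"

definition column_stabilizer ::
    "nat list \<Rightarrow> 'v set \<Rightarrow> (nat \<times> nat \<Rightarrow> 'v) \<Rightarrow> ('v \<Rightarrow> 'v) set" where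
  "column_stabilizer p I t =
     {q. q permutes I \<and> (\<forall>c. q ` tableau_column p t c = tableau_column p t c)}"

text \<open>Elements of the permutation module on tabloids are written as coefficient functions.\<close>

definition polytabloid ::
    "nat list \<Rightarrow> 'v set \<Rightarrow> (nat \<times> nat \<Rightarrow> 'v) \<Rightarrow> (nat \<Rightarrow> 'v set) \<Rightarrow> real" where
  "polytabloid p I t =
     (\<lambda>T. \<Sum>q\<in>column_stabilizer p I t.
            of_int (sign q) * (if tabloid p (q \<circ> t) = T then 1 else 0))"

definition specht_module :: "nat list \<Rightarrow> 'v set \<Rightarrow> ((nat \<Rightarrow> 'v set) \<Rightarrow> real) set" where
  "specht_module p I = fun_space.span (polytabloid p I ` tableaux p I)"

text \<open>On coefficient functions, the linear extension of \<open>T \<mapsto> (\<lambda>r. \<sigma> ` T r)\<close> is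
  precomposition with the action of the inverse permutation.\<close>

definition perm_action ::
    "('v \<Rightarrow> 'v) \<Rightarrow> ((nat \<Rightarrow> 'v set) \<Rightarrow> real) \<Rightarrow> (nat \<Rightarrow> 'v set) \<Rightarrow> real" where
  "perm_action \<sigma> f = (\<lambda>T. f (\<lambda>r. inv \<sigma> ` T r))"

definition irr_character :: "nat list \<Rightarrow> 'v set \<Rightarrow> ('v \<Rightarrow> 'v) \<Rightarrow> real" where
  "irr_character p I \<sigma> = trace_on (specht_module p I) (perm_action \<sigma>)"


section \<open>Hook immanants\<close>

definition hook_partition :: "nat \<Rightarrow> nat \<Rightarrow> nat list" where
  "hook_partition m j = j # replicate (m - j) 1"

text \<open>
  Square matrices are indexed by a finite set \<open>I\<close>, so that a principal submatrix is obtained by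
  passing to a subset of \<open>I\<close>. For nonempty \<open>I\<close>, the value is 0 unless \<open>1 \<le> j \<le> card I\<close>.

  The matrix with no rows needs a convention of its own, since the vertex and edge expansions
  reach it whenever all vertices are deleted (for instance along a Hamiltonian cycle). The value
  chosen here is the usual one for the hook Schur function \<open>s(a|b)\<close> in Frobenius notation with
  \<open>a = j - 1\<close>, \<open>b = - j\<close>: if \<open>a + b = -1\<close>, the expansion
  \<open>s(a|b) = h(a+1) e(b) - h(a+2) e(b-1) + \<dots> + (-1)^b h(a+b+1)\<close> equals \<open>(-1)^b\<close>
  for \<open>b \<ge> 0\<close> and 0 for \<open>b < 0\<close>. In particular the value for \<open>j = 0\<close> is 1, the empty
  product. Taking 0 for every \<open>j\<close> would make the vertex expansion fail for a single vertex:
  there the first hook immanant of \<open>(x)\<close> is \<open>x\<close>, but the right-hand side would vanish.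
\<close>

definition hook_immanant :: "'v set \<Rightarrow> int \<Rightarrow> ('v \<Rightarrow> 'v \<Rightarrow> real) \<Rightarrow> real" where
  "hook_immanant I j M =
     (if I = {} then (if j \<le> 0 then (-1) ^ nat (- j) else 0)
      else if 1 \<le> j \<and> j \<le> int (card I) then
        (\<Sum>\<sigma> | \<sigma> permutes I.
           irr_character (hook_partition (card I) (nat j)) I \<sigma> * (\<Prod>i\<in>I. M i (\<sigma> i)))
      else 0)"

definition hook_immanantal_poly :: "'v set \<Rightarrow> int \<Rightarrow> ('v \<Rightarrow> 'v \<Rightarrow> real) \<Rightarrow> real \<Rightarrow> real" where
  "hook_immanantal_poly I j M x = hook_immanant I j (\<lambda>u v. (if u = v then x else 0) - M u v)"


section \<open>Simple graphs\<close>

definition simple_graph :: "'v set \<Rightarrow> 'v set set \<Rightarrow> bool" where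
  "simple_graph V E \<longleftrightarrow> finite V \<and> (\<forall>e\<in>E. e \<subseteq> V \<and> card e = 2)"

definition neighbours :: "'v set set \<Rightarrow> 'v \<Rightarrow> 'v set" where
  "neighbours E v = {u. {u, v} \<in> E}"

definition degree :: "'v set set \<Rightarrow> 'v \<Rightarrow> nat" where
  "degree E v = card (neighbours E v)"

definition degree_matrix :: "'v set set \<Rightarrow> 'v \<Rightarrow> 'v \<Rightarrow> real" where
  "degree_matrix E u v = (if u = v then real (degree E u) else 0)"

definition adjacency_matrix :: "'v set set \<Rightarrow> 'v \<Rightarrow> 'v \<Rightarrow> real" where
  "adjacency_matrix E u v = (if {u, v} \<in> E then 1 else 0)"

definition H_matrix :: "real \<Rightarrow> real \<Rightarrow> 'v set set \<Rightarrow> 'v \<Rightarrow> 'v \<Rightarrow> real" where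
  "H_matrix \<beta> \<gamma> E u v = \<beta> * degree_matrix E u v + \<gamma> * adjacency_matrix E u v"

definition cycle_edges :: "'v list \<Rightarrow> 'v set set" where
  "cycle_edges vs = {{vs ! i, vs ! ((i + 1) mod length vs)} | i. i < length vs}"

text \<open>Cycles are subgraphs, given by their vertex set and edge set, so that neither the starting
  vertex nor the direction of traversal matters.\<close>

definition cycles :: "'v set set \<Rightarrow> ('v set \<times> 'v set set) set" where
  "cycles E =
     {(set vs, cycle_edges vs) | vs. distinct vs \<and> 3 \<le> length vs \<and> cycle_edges vs \<subseteq> E}"

definition cycles_through_vertex :: "'v set set \<Rightarrow> 'v \<Rightarrow> ('v set \<times> 'v set set) set" where
  "cycles_through_vertex E v = {C \<in> cycles E. v \<in> fst C}"

definition cycles_through_edge :: "'v set set \<Rightarrow> 'v set \<Rightarrow> ('v set \<times> 'v set set) set" where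
  "cycles_through_edge E e = {C \<in> cycles E. e \<in> snd C}"

end

theory Submission
  imports Defs "HOL-Combinatorics.Cycles"
begin

text \<open>
  A tabloid of hook shape \<open>(j, 1^r)\<close> is an arrangement of \<open>r\<close> distinct points, and the
  polytabloid with first column \<open>a, x1, \<dots>, xr\<close> is the simplicial boundary of
  \<open>a \<and> x1 \<and> \<dots> \<and> xr\<close>. Boundaries are determined by their coefficients at the
  arrangements avoiding a fixed point \<open>v\<close>, and the cones with apex \<open>v\<close> form the dual basis,
  so the hook character can be read off as a signed count of partial permutations, for any choice
  of \<open>v\<close>. Choosing \<open>v\<close> outside a cycle \<open>c\<close> of length \<open>l\<close> gives the
  Murnaghan--Nakayama rule \<open>\<chi>_j(c \<sigma>) = \<chi>_(j-l)(\<sigma>) + (-1)^(l+1) \<chi>_j(\<sigma>)\<close>.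
  Sorting permutations by their cycle through a vertex expands the immanant of an arbitrary matrix
  along that vertex; cycles of length at least 3 come in pairs of opposite orientation. For an edge
  \<open>uv\<close>, the matrix of \<open>G\<close> arises from that of \<open>G - uv\<close> by changing the diagonal entries at
  \<open>v\<close> and \<open>u\<close> and then the two entries of the edge, and each change only affects the
  corresponding terms of the expansion along \<open>u\<close> or \<open>v\<close>.
\<close>

section \<open>Traces from a dual family of coordinates\<close>

text \<open>The character is a trace over an unspecified basis of a span of polytabloids; it is read
  off evaluations at tabloids. One obstacle remains: a cycle through all points leaves no apex
  outside it. There the character of shape \<open>(j, 1^(l-j))\<close> is computed directly as
  \<open>(-1)^(l-j)\<close>, where \<open>l\<close> is the length, and the values on the empty set
  make the removal rule hold for this cycle and every integer \<open>j\<close>.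

  The shape of both formulas comes from the lengths 1, 2 and at least 3 of the cycle through the
  root. Write \<open>s\<close> for the shift of \<open>k\<close> to \<open>k - 1\<close>; removing a
  cycle of length \<open>l\<close> contributes \<open>s^l + (-1)^(l+1)\<close>. A fixed point gives
  \<open>s + 1\<close>; an edge used back and forth gives \<open>s^2 - 1\<close>, with entry product
  \<open>\<gamma>^2\<close>. Raising the degree at one end of \<open>uv\<close> subtracts
  \<open>\<beta> (1 + s)\<close> applied to the smaller matrix, so both ends together leave
  \<open>\<beta>^2 (1 + s)^2\<close> on the complement of \<open>{u, v}\<close>. Adding
  \<open>\<gamma>^2 (s^2 - 1)\<close> gives the coefficients \<open>\<beta>^2 - \<gamma>^2\<close>,
  \<open>2 \<beta>^2\<close> and \<open>\<beta>^2 + \<gamma>^2\<close>.\<close>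

lemma trace_on_eq_sum:
  fixes g :: "'i \<Rightarrow> 'a \<Rightarrow> real" and x :: "'i \<Rightarrow> 'a"
  assumes fin: "finite X" and W: "fun_space.subspace W"
    and g: "\<And>i. i \<in> X \<Longrightarrow> g i \<in> W"
    and expand: "\<And>w. w \<in> W \<Longrightarrow> w = (\<Sum>i\<in>X. scale_fun (w (x i)) (g i))"
    and f: "Vector_Spaces.linear scale_fun scale_fun f" and stable: "f ` W \<subseteq> W"
  shows "trace_on W f = (\<Sum>i\<in>X. f (g i) (x i))"
proof -
  have sum_app: "(\<Sum>i\<in>A. h i) a = (\<Sum>i\<in>A. h i a)" for h :: "'j \<Rightarrow> 'a \<Rightarrow> real" and A a
    by (induction A rule: infinite_finite_induct) auto
  define B where "B = (SOME B. fun_space.independent B \<and> fun_space.span B = W)"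
  have "\<exists>B. fun_space.independent B \<and> fun_space.span B = W"
  proof -
    obtain B where "B \<subseteq> W" "fun_space.independent B" "W \<subseteq> fun_space.span B"
      using fun_space.maximal_independent_subset by blast
    moreover have "fun_space.span B \<subseteq> W"
      using \<open>B \<subseteq> W\<close> W by (rule fun_space.span_minimal)
    ultimately show ?thesis by blast
  qed
  then have B: "fun_space.independent B" "fun_space.span B = W"
    unfolding B_def by (metis (mono_tags, lifting) someI_ex)+
  have "W \<subseteq> fun_space.span (g ` X)"
  proof
    fix w assume "w \<in> W"
    have "(\<Sum>i\<in>X. scale_fun (w (x i)) (g i)) \<in> fun_space.span (g ` X)"
      by (intro fun_space.span_sum fun_space.span_scale fun_space.span_base) auto
    then show "w \<in> fun_space.span (g ` X)" using expand[OF \<open>w \<in> W\<close>] by metis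
  qed
  then have finB: "finite B"
    using B fin fun_space.independent_span_bound[of "g ` X" B] fun_space.span_superset[of B] by auto
  interpret f: Vector_Spaces.linear scale_fun scale_fun f by (fact f)
  have fb: "f b \<in> W" if "b \<in> B" for b
    using that stable B fun_space.span_base by blast
  let ?R = "fun_space.representation B"
  have "trace_on W f = (\<Sum>b\<in>B. ?R (f b) b)"
    by (simp add: trace_on_def B_def Let_def)
  \<comment> \<open>The expansion writes the identity of \<open>W\<close> as a sum of rank one maps,
    the value at \<open>x i\<close> times \<open>g i\<close>. Moving \<open>f\<close> past it turns
    the trace into the values of \<open>f (g i)\<close> at \<open>x i\<close>, whatever basis
    \<open>B\<close> was picked.\<close>
  also have "\<dots> = (\<Sum>b\<in>B. \<Sum>i\<in>X. f b (x i) * ?R (g i) b)"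
  proof (rule sum.cong[OF refl])
    fix b assume "b \<in> B"
    have "?R (f b) b = ?R (\<Sum>i\<in>X. scale_fun (f b (x i)) (g i)) b"
      using expand[OF fb[OF \<open>b \<in> B\<close>]] by metis
    also have "\<dots> = (\<Sum>i\<in>X. ?R (scale_fun (f b (x i)) (g i)) b)"
      using B g by (subst fun_space.representation_sum) (auto intro: fun_space.span_scale simp: sum_app)
    also have "\<dots> = (\<Sum>i\<in>X. f b (x i) * ?R (g i) b)"
      using B g by (intro sum.cong refl) (simp add: fun_space.representation_scale)
    finally show "?R (f b) b = (\<Sum>i\<in>X. f b (x i) * ?R (g i) b)" .
  qed
  also have "\<dots> = (\<Sum>i\<in>X. \<Sum>b\<in>B. f b (x i) * ?R (g i) b)"
    by (rule sum.swap)
  also have "\<dots> = (\<Sum>i\<in>X. f (g i) (x i))"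
  proof (rule sum.cong[OF refl])
    fix i assume "i \<in> X"
    have "f (g i) = f (\<Sum>b\<in>B. scale_fun (?R (g i) b) b)"
      using fun_space.sum_representation_eq[OF B(1) _ finB, of "g i"] B g[OF \<open>i \<in> X\<close>] by simp
    also have "\<dots> = (\<Sum>b\<in>B. scale_fun (?R (g i) b) (f b))"
      by (simp add: f.sum f.scale)
    finally show "(\<Sum>b\<in>B. f b (x i) * ?R (g i) b) = f (g i) (x i)"
      by (simp add: sum_app scale_fun_def mult.commute)
  qed
  finally show ?thesis .
qed

section \<open>Specht modules of hook shape\<close>

definition tabloid_of :: "'v set \<Rightarrow> 'v list \<Rightarrow> nat \<Rightarrow> 'v set" where
  "tabloid_of I xs = (\<lambda>i. if i = 0 then I - set xs else if i \<le> length xs then {xs ! (i - 1)} else {})"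

text \<open>The corner \<open>a\<close> enters through the summation range alone, because row 0 is
  the complement of the leg. A permutation \<open>q\<close> drops the point \<open>q a\<close> from
  the simplex, so every face occurs once for each ordering of its points, with the matching
  sign.\<close>

definition hook_polytabloid :: "'v set \<Rightarrow> 'v \<Rightarrow> 'v list \<Rightarrow> (nat \<Rightarrow> 'v set) \<Rightarrow> real" where
  "hook_polytabloid I a xs =
     (\<lambda>T. \<Sum>q | q permutes insert a (set xs).
            of_int (sign q) * (if tabloid_of I (map q xs) = T then 1 else 0))"

lemma tabloid_of_inj:
  assumes "tabloid_of I xs = tabloid_of I ys" "length xs = length ys"
  shows "xs = ys"
proof (rule nth_equalityI)
  fix i assume "i < length xs"
  then show "xs ! i = ys ! i"
    using fun_cong[OF assms(1), of "Suc i"] assms(2) by (simp add: tabloid_of_def)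
qed (fact assms)

lemma tabloid_of_image:
  assumes "\<sigma> permutes I"
  shows "(\<lambda>i. \<sigma> ` tabloid_of I xs i) = tabloid_of I (map \<sigma> xs)"
  by (rule ext) (simp add: tabloid_of_def image_set_diff[OF permutes_inj[OF assms]] permutes_image[OF assms])

lemma young_diagram_hook:
  assumes "1 \<le> j"
  shows "(i, c) \<in> young_diagram (hook_partition n j) \<longleftrightarrow> (i = 0 \<and> c < j) \<or> (c = 0 \<and> 1 \<le> i \<and> i \<le> n - j)"
  using assms by (cases i) (auto simp: young_diagram_def hook_partition_def nth_Cons')

definition hook_leg :: "nat \<Rightarrow> (nat \<times> nat \<Rightarrow> 'v) \<Rightarrow> 'v list" where
  "hook_leg r t = map (\<lambda>i. t (Suc i, 0)) [0..<r]"

lemma hook_tableau_leg: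
  assumes j: "1 \<le> j" and t: "t \<in> tableaux (hook_partition n j) I"
  shows "distinct (t (0, 0) # hook_leg (n - j) t)" "set (t (0, 0) # hook_leg (n - j) t) \<subseteq> I"
    and "I = set (t (0, 0) # hook_leg (n - j) t) \<union> {t (0, c) | c. 0 < c \<and> c < j}"
    and "\<And>c. 0 < c \<Longrightarrow> c < j \<Longrightarrow> t (0, c) \<notin> set (t (0, 0) # hook_leg (n - j) t)"
proof -
  let ?Y = "young_diagram (hook_partition n j)"
  have bij: "bij_betw t ?Y I" using t by (simp add: tableaux_def)
  then have inj: "inj_on t ?Y" and img: "t ` ?Y = I" by (auto simp: bij_betw_def)
  have Y: "?Y = {(0, c) | c. c < j} \<union> {(Suc i, 0) | i. i < n - j}" (is "_ = ?Z")
  proof -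
    have "y \<in> ?Y \<longleftrightarrow> y \<in> ?Z" for y
      by (cases y; cases "fst y") (auto simp: young_diagram_hook[OF j])
    then show ?thesis by blast
  qed
  have leg_inj: "t (Suc i, 0) = t (Suc i', 0) \<longleftrightarrow> i = i'" if "i < n - j" "i' < n - j" for i i'
    using inj_onD[OF inj, of "(Suc i, 0)" "(Suc i', 0)"] that by (auto simp: Y)
  have arm_leg: "t (0, c) \<noteq> t (Suc i, 0)" "t (Suc i, 0) \<noteq> t (0, c)" if "i < n - j" "c < j" for i c
    using inj_onD[OF inj, of "(0, c)" "(Suc i, 0)"] that by (auto simp: Y)
  have arm: "t (0, 0) \<noteq> t (0, c)" if "0 < c" "c < j" for c
    using inj_onD[OF inj, of "(0, 0)" "(0, c)"] that by (auto simp: Y)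
  show "distinct (t (0, 0) # hook_leg (n - j) t)"
    using j arm_leg by (auto simp: hook_leg_def distinct_map inj_on_def leg_inj)
  show "set (t (0, 0) # hook_leg (n - j) t) \<subseteq> I"
    using j by (auto simp: hook_leg_def img[symmetric] Y)
  have "t (0, c) = t (0, 0) \<or> t (0, c) \<in> {t (0, c) | c. 0 < c \<and> c < j}" if "c < j" for c
    using that by (cases "c = 0") auto
  then show "I = set (t (0, 0) # hook_leg (n - j) t) \<union> {t (0, c) | c. 0 < c \<and> c < j}"
    using j unfolding img[symmetric] Y by (fastforce simp: hook_leg_def)
  show "t (0, c) \<notin> set (t (0, 0) # hook_leg (n - j) t)" if "0 < c" "c < j" for c
    using that by (simp add: hook_leg_def image_iff arm_leg(1) arm[symmetric])
qed

lemma tabloid_hook: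
  assumes j: "1 \<le> j" and t: "t \<in> tableaux (hook_partition n j) I" and q: "q permutes I"
  shows "tabloid (hook_partition n j) (q \<circ> t) = tabloid_of I (map q (hook_leg (n - j) t))"
proof
  fix i
  have row0: "{t (0, c) | c. c < j} = I - set (hook_leg (n - j) t)"
  proof -
    have "{t (0, c) | c. c < j} = insert (t (0,0)) {t (0, c) | c. 0 < c \<and> c < j}"
      using j by (auto; metis gr_zeroI)
    then show ?thesis using hook_tableau_leg(1,3,4)[OF j t] by auto
  qed
  show "tabloid (hook_partition n j) (q \<circ> t) i = tabloid_of I (map q (hook_leg (n - j) t)) i"
  proof (cases i)
    case 0
    have "tabloid (hook_partition n j) (q \<circ> t) 0 = q ` {t (0, c) | c. c < j}"
      by (auto simp: tabloid_def young_diagram_hook[OF j])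
    also have "\<dots> = tabloid_of I (map q (hook_leg (n - j) t)) 0"
      by (simp add: row0 tabloid_of_def image_set_diff permutes_inj[OF q] permutes_image[OF q])
    finally show ?thesis using 0 by simp
  next
    case (Suc i')
    then show ?thesis
      by (auto simp: tabloid_def tabloid_of_def young_diagram_hook[OF j] hook_leg_def)
  qed
qed

text \<open>Columns other than column 0 have at most one cell. A stabilizing permutation therefore
  fixes every arm point except possibly the corner, and is arbitrary on column 0.\<close>

lemma column_stabilizer_hook:
  assumes j: "1 \<le> j" and t: "t \<in> tableaux (hook_partition n j) I"
  shows "column_stabilizer (hook_partition n j) I t =
    {q. q permutes insert (t (0, 0)) (set (hook_leg (n - j) t))}" (is "?L = {q. q permutes ?A}")
proof -
  note leg = hook_tableau_leg[OF j t]
  have col0: "tableau_column (hook_partition n j) t 0 = ?A"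
    using j by (auto simp: tableau_column_def young_diagram_hook[OF j] hook_leg_def image_iff)
      (metis Suc_le_D Suc_le_lessD atLeastLessThan_iff le0)
  have col: "tableau_column (hook_partition n j) t c = (if c < j then {t (0, c)} else {})" if "0 < c" for c
    using that j by (auto simp: tableau_column_def young_diagram_hook[OF j])
  show ?thesis
  proof (intro set_eqI iffI; clarsimp)
    fix q assume "q \<in> ?L"
    then have q: "q permutes I" and qc: "\<And>c. q ` tableau_column (hook_partition n j) t c = tableau_column (hook_partition n j) t c"
      by (auto simp: column_stabilizer_def)
    show "q permutes ?A"
    proof (rule permutes_superset[OF q])
      fix x assume "x \<in> I - ?A"
      then obtain c where "0 < c" "c < j" "x = t (0, c)" using leg by auto
      then show "q x = x" using qc[of c] col[of c] by auto
    qed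
  next
    fix q assume q: "q permutes ?A"
    have "q ` tableau_column (hook_partition n j) t c = tableau_column (hook_partition n j) t c" for c
    proof (cases "c = 0")
      case True
      then show ?thesis using permutes_image[OF q] by (simp add: col0)
    next
      case False
      then have "q (t (0, c)) = t (0, c)" if "c < j"
        using leg(4)[of c] that by (intro permutes_not_in[OF q]) simp
      then show ?thesis using col[of c] False by simp
    qed
    moreover have "q permutes I" using leg(2) by (intro permutes_subset[OF q]) simp
    ultimately show "q \<in> ?L" by (simp add: column_stabilizer_def)
  qed
qed

lemma polytabloid_hook:
  assumes j: "1 \<le> j" and t: "t \<in> tableaux (hook_partition n j) I"
  shows "polytabloid (hook_partition n j) I t = hook_polytabloid I (t (0, 0)) (hook_leg (n - j) t)"
proof -
  have "q permutes I" if "q permutes insert (t (0, 0)) (set (hook_leg (n - j) t))" for q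
    using hook_tableau_leg[OF j t] that by (auto intro: permutes_subset)
  then show ?thesis
    unfolding polytabloid_def hook_polytabloid_def column_stabilizer_hook[OF j t]
    by (intro ext sum.cong refl) (simp add: tabloid_hook[OF j t])
qed

text \<open>Realizes every prescribed first column. The cells right of the corner may be filled by
  any bijection, since the polytabloid depends on corner and leg only.\<close>

lemma hook_tableau_exists:
  assumes fin: "finite I" and j: "1 \<le> j" "j \<le> card I"
    and xs: "distinct (a # xs)" "set (a # xs) \<subseteq> I" "length xs = card I - j"
  shows "\<exists>t\<in>tableaux (hook_partition (card I) j) I. t (0, 0) = a \<and> hook_leg (card I - j) t = xs"
proof -
  let ?Y = "young_diagram (hook_partition (card I) j)"
  have "card (I - set (a # xs)) = j - 1"
    using xs j fin by (subst card_Diff_subset) (auto simp: distinct_card)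
  then obtain h where h: "bij_betw h {1..<j} (I - set (a # xs))"
    using finite_same_card_bij[of "{1..<j}" "I - set (a # xs)"] fin by auto
  define t where "t = (\<lambda>(i, c). if i = 0 then (if c = (0::nat) then a else h c) else xs ! (i - 1))"
  have Y: "?Y = insert (0, 0) ({0} \<times> {1..<j} \<union> Suc ` {..<length xs} \<times> {0})" (is "_ = ?Z")
  proof -
    have "y \<in> ?Y \<longleftrightarrow> y \<in> ?Z" for y
      using j by (cases y; cases "fst y") (auto simp: young_diagram_hook[OF j(1)] xs(3))
    then show ?thesis by blast
  qed
  have "bij_betw t ({0} \<times> {1..<j}) (I - set (a # xs))"
  proof -
    have "inj_on t ({0} \<times> {1..<j})"
      using h by (auto simp: inj_on_def t_def bij_betw_def)
    moreover have "t ` ({0} \<times> {1..<j}) = h ` {1..<j}"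
      by (force simp: t_def image_iff)
    ultimately show ?thesis using h by (simp add: bij_betw_def)
  qed
  moreover have "bij_betw t (Suc ` {..<length xs} \<times> {0}) (set xs)"
  proof -
    have "inj_on t (Suc ` {..<length xs} \<times> {0})"
      using xs by (auto simp: inj_on_def t_def nth_eq_iff_index_eq)
    moreover have "t ` (Suc ` {..<length xs} \<times> {0}) = set xs"
      by (force simp: t_def image_iff in_set_conv_nth)
    ultimately show ?thesis by (simp add: bij_betw_def)
  qed
  ultimately have "bij_betw t ({0} \<times> {1..<j} \<union> Suc ` {..<length xs} \<times> {0}) ((I - set (a # xs)) \<union> set xs)"
    by (intro bij_betw_combine) auto
  then have "bij_betw t ?Y (insert (t (0,0)) ((I - set (a # xs)) \<union> set xs))"
    unfolding Y using xs notIn_Un_bij_betw[of "(0, 0)" _ t] by (auto simp: t_def)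
  moreover have "insert (t (0,0)) ((I - set (a # xs)) \<union> set xs) = I"
    using xs by (auto simp: t_def)
  moreover have "hook_leg (card I - j) t = xs"
    unfolding hook_leg_def t_def xs(3)[symmetric] by (rule nth_equalityI) auto
  ultimately show ?thesis by (intro bexI[of _ t]) (auto simp: tableaux_def t_def)
qed

section \<open>Alternating functions with vanishing boundary\<close>

definition arrangements :: "'v set \<Rightarrow> nat \<Rightarrow> 'v list set" where
  "arrangements I r = {xs. distinct xs \<and> set xs \<subseteq> I \<and> length xs = r}"

text \<open>The last condition says that the simplicial boundary vanishes.\<close>

definition alternating_cycles :: "'v set \<Rightarrow> nat \<Rightarrow> ((nat \<Rightarrow> 'v set) \<Rightarrow> real) set" where
  "alternating_cycles I r = {f.
     (\<forall>T. f T \<noteq> 0 \<longrightarrow> T \<in> tabloid_of I ` arrangements I r) \<and>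
     (\<forall>xs\<in>arrangements I r. \<forall>q. q permutes set xs \<longrightarrow>
        f (tabloid_of I (map q xs)) = of_int (sign q) * f (tabloid_of I xs)) \<and>
     (\<forall>zs. Suc (length zs) = r \<longrightarrow> distinct zs \<longrightarrow> set zs \<subseteq> I \<longrightarrow>
        (\<Sum>a\<in>I - set zs. f (tabloid_of I (a # zs))) = 0)}"

lemma subspace_alternating_cycles: "fun_space.subspace (alternating_cycles I r)"
proof (rule fun_space.subspaceI)
  show "0 \<in> alternating_cycles I r" by (simp add: alternating_cycles_def)
next
  fix f g assume f: "f \<in> alternating_cycles I r" and g: "g \<in> alternating_cycles I r"
  show "f + g \<in> alternating_cycles I r"
    unfolding alternating_cycles_def mem_Collect_eq
  proof (intro conjI allI ballI impI)
    fix T assume "(f + g) T \<noteq> 0"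
    then have "f T \<noteq> 0 \<or> g T \<noteq> 0" by auto
    then show "T \<in> tabloid_of I ` arrangements I r"
      using f g unfolding alternating_cycles_def by blast
  next
    fix xs q assume "xs \<in> arrangements I r" "q permutes set xs"
    then show "(f + g) (tabloid_of I (map q xs)) = of_int (sign q) * (f + g) (tabloid_of I xs)"
      using f g by (simp add: alternating_cycles_def distrib_left)
  next
    fix zs assume "Suc (length zs) = r" "distinct zs" "set zs \<subseteq> I"
    then show "(\<Sum>a\<in>I - set zs. (f + g) (tabloid_of I (a # zs))) = 0"
      using f g by (simp add: alternating_cycles_def sum.distrib)
  qed
next
  fix f c assume "f \<in> alternating_cycles I r"
  then show "scale_fun c f \<in> alternating_cycles I r"
    by (simp add: alternating_cycles_def scale_fun_def sum_distrib_left[symmetric])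
qed

lemma hook_polytabloid_apply:
  assumes "length xs = length ys"
  shows "hook_polytabloid I a ys (tabloid_of I xs) =
    (\<Sum>q | q permutes insert a (set ys). of_int (sign q) * (if map q ys = xs then 1 else 0))"
proof -
  have "tabloid_of I (map q ys) = tabloid_of I xs \<longleftrightarrow> map q ys = xs" for q
    using tabloid_of_inj[of I "map q ys" xs] assms by auto
  then show ?thesis by (simp add: hook_polytabloid_def)
qed

lemma hook_polytabloid_mem:
  assumes fin: "finite I" and ys: "distinct (a # ys)" "set (a # ys) \<subseteq> I" "length ys = r"
  shows "hook_polytabloid I a ys \<in> alternating_cycles I r"
proof -
  let ?A = "insert a (set ys)"
  have perm: "permutation q" if "q permutes ?A" for q
    using that permutes_imp_permutation[of ?A q] by simp
  have "T \<in> tabloid_of I ` arrangements I r" if "hook_polytabloid I a ys T \<noteq> 0" for T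
  proof -
    have "\<exists>q. q permutes ?A \<and> tabloid_of I (map q ys) = T"
    proof (rule ccontr)
      assume "\<not> ?thesis"
      then have "hook_polytabloid I a ys T = 0"
        unfolding hook_polytabloid_def by (intro sum.neutral) auto
      then show False using that by simp
    qed
    then obtain q where q: "q permutes ?A" "tabloid_of I (map q ys) = T" by blast
    have "q ` set ys \<subseteq> ?A" using permutes_image[OF q(1)] by blast
    then have "map q ys \<in> arrangements I r"
      using ys q by (auto simp: arrangements_def distinct_map permutes_inj_on)
    then show ?thesis using q by blast
  qed
  moreover have "hook_polytabloid I a ys (tabloid_of I (map p xs)) =
      of_int (sign p) * hook_polytabloid I a ys (tabloid_of I xs)"
    if xs: "xs \<in> arrangements I r" and p: "p permutes set xs" for xs p
  proof (cases "set xs \<subseteq> ?A")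
    case True
    have p': "p permutes ?A" using p True by (rule permutes_subset)
    have inj: "inj p" using p by (rule permutes_inj)
    have "hook_polytabloid I a ys (tabloid_of I (map p xs)) =
        (\<Sum>q | q permutes ?A. of_int (sign q) * (if map q ys = map p xs then 1 else 0))"
      using xs ys by (intro hook_polytabloid_apply) (simp add: arrangements_def)
    also have "\<dots> = (\<Sum>q | q permutes ?A. of_int (sign (p \<circ> q)) * (if map (p \<circ> q) ys = map p xs then 1 else 0))"
      by (rule setum_permutations_compose_left[OF p'])
    also have "\<dots> = (\<Sum>q | q permutes ?A. of_int (sign p) * (of_int (sign q) * (if map q ys = xs then 1 else 0)))"
    proof (rule sum.cong[OF refl])
      fix q assume q: "q \<in> {q. q permutes ?A}"
      have "map (p \<circ> q) ys = map p xs \<longleftrightarrow> map q ys = xs"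
        using inj_map_eq_map[OF inj] by (metis map_map)
      then show "of_int (sign (p \<circ> q)) * (if map (p \<circ> q) ys = map p xs then 1 else 0) =
         of_int (sign p) * (of_int (sign q) * (if map q ys = xs then 1 else 0 :: real))"
        using perm p' q by (simp add: sign_compose)
    qed
    also have "\<dots> = of_int (sign p) * hook_polytabloid I a ys (tabloid_of I xs)"
      using xs ys by (subst hook_polytabloid_apply) (simp_all add: arrangements_def sum_distrib_left)
    finally show ?thesis .
  next
    \<comment> \<open>A point of \<open>xs\<close> outside the simplex occurs in no
      \<open>map q ys\<close>, and permuting \<open>xs\<close> keeps it there, so both sides are
      0.\<close>
    case False
    have "hook_polytabloid I a ys (tabloid_of I zs) = 0" if "set zs = set xs" "length zs = length xs" for zs
    proof -
      have "map q ys \<noteq> zs" if "q permutes ?A" for q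
      proof
        assume "map q ys = zs"
        then have "q ` set ys = set xs" using \<open>set zs = set xs\<close> by auto
        then show False using False permutes_image[OF that] by blast
      qed
      then show ?thesis
        using xs ys that by (subst hook_polytabloid_apply) (auto simp: arrangements_def intro!: sum.neutral)
    qed
    from this[of xs] this[of "map p xs"] show ?thesis
      using permutes_image[OF p] by simp
  qed
  moreover have "(\<Sum>b\<in>I - set zs. hook_polytabloid I a ys (tabloid_of I (b # zs))) = 0"
    if r: "Suc (length zs) = r" and zs: "distinct zs" "set zs \<subseteq> I" for zs
  proof -
    obtain y ys' where Cons: "ys = y # ys'" using r ys by (cases ys) auto
    let ?s = "\<lambda>q. of_int (sign q) * (if map q ys' = zs then 1 else 0 :: real)"
    have "(\<Sum>b\<in>I - set zs. hook_polytabloid I a ys (tabloid_of I (b # zs))) =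
        (\<Sum>b\<in>I - set zs. \<Sum>q | q permutes ?A. of_int (sign q) * (if map q ys = b # zs then 1 else 0))"
      using r ys by (intro sum.cong refl hook_polytabloid_apply) simp
    also have "\<dots> = (\<Sum>q | q permutes ?A. \<Sum>b\<in>I - set zs. of_int (sign q) * (if map q ys = b # zs then 1 else 0))"
      by (rule sum.swap)
    also have "\<dots> = (\<Sum>q | q permutes ?A. ?s q)"
    proof (rule sum.cong[OF refl])
      fix q assume "q \<in> {q. q permutes ?A}"
      then have q: "q permutes ?A" by simp
      have "q y \<in> I" using permutes_in_image[OF q, of y] ys Cons by auto
      moreover have "q y \<notin> set zs" if "map q ys' = zs"
        using that ys(1) Cons inj_image_mem_iff[OF permutes_inj[OF q], of y "set ys'"] by auto
      ultimately have mem: "q y \<in> I - set zs" if "map q ys' = zs" using that by blast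
      \<comment> \<open>For a given \<open>q\<close> the only \<open>b\<close> that can match is
        \<open>q y\<close>; summing over \<open>b\<close> just forgets the first entry of
        \<open>map q ys\<close>.\<close>
      have "(\<Sum>b\<in>I - set zs. of_int (sign q) * (if map q ys = b # zs then 1 else 0 :: real)) =
        (\<Sum>b\<in>I - set zs. if b = q y then ?s q else 0)"
        by (rule sum.cong) (auto simp: Cons)
      also have "\<dots> = ?s q" using mem fin by (auto simp: sum.delta)
      finally show "(\<Sum>b\<in>I - set zs. of_int (sign q) * (if map q ys = b # zs then 1 else 0 :: real)) = ?s q" .
    qed
    also have "\<dots> = 0"
    proof -
      \<comment> \<open>Neither \<open>a\<close> nor \<open>y\<close> occurs in \<open>ys'\<close>,
        so precomposing with their transposition changes nothing but the sign.\<close>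
      let ?t = "transpose a y"
      have t: "?t permutes ?A" using Cons by (intro permutes_swap_id) auto
      have "(\<Sum>q | q permutes ?A. ?s q) = (\<Sum>q | q permutes ?A. ?s (q \<circ> ?t))"
        by (rule sum_permutations_compose_right[OF t])
      also have "\<dots> = (\<Sum>q | q permutes ?A. - ?s q)"
      proof (rule sum.cong[OF refl])
        fix q assume q: "q \<in> {q. q permutes ?A}"
        have "map (q \<circ> ?t) ys' = map q ys'"
          using ys(1) Cons by (auto simp: transpose_def)
        then show "?s (q \<circ> ?t) = - ?s q"
          using perm t q ys(1) Cons by (auto simp: sign_compose sign_swap_id)
      qed
      finally show ?thesis by (simp add: sum_negf)
    qed
    finally show ?thesis .
  qed
  ultimately show ?thesis by (simp add: alternating_cycles_def)
qed

lemma exists_permutation_map: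
  assumes "distinct xs" "distinct ys" "set xs = set ys"
  shows "\<exists>q. q permutes set xs \<and> map q xs = ys"
proof -
  have len: "length xs = length ys" using assms by (metis distinct_card)
  define q where "q = (\<lambda>x. if x \<in> set xs then the (map_of (zip xs ys) x) else x)"
  have nth: "q (xs ! i) = ys ! i" if "i < length xs" for i
    using that assms(1) len by (simp add: q_def map_of_zip_nth)
  then have map: "map q xs = ys" using len by (intro nth_equalityI) auto
  then have "q ` set xs = set xs" using assms by (metis list.set_map)
  then have "bij_betw q (set xs) (set xs)"
    by (simp add: bij_betw_def eq_card_imp_inj_on)
  then have "q permutes set xs" by (rule bij_imp_permutes) (simp add: q_def)
  then show ?thesis using map by blast
qed

text \<open>Alternation reduces the arrangements avoiding \<open>v\<close> to one ordering
  \<open>L S\<close> of each set. If an arrangement contains \<open>v\<close>, move \<open>v\<close>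
  to the front: in the boundary relation of the remaining points every other term avoids
  \<open>v\<close>, so this term vanishes too. Hence the evaluations at the \<open>L S\<close>
  separate the elements of the space.\<close>

lemma alternating_cycles_eq_zero:
  assumes fin: "finite I" and f: "f \<in> alternating_cycles I r" and v: "v \<in> I"
    and L: "\<And>S. S \<subseteq> I - {v} \<Longrightarrow> card S = r \<Longrightarrow> distinct (L S) \<and> set (L S) = S"
    and zero: "\<And>S. S \<subseteq> I - {v} \<Longrightarrow> card S = r \<Longrightarrow> f (tabloid_of I (L S)) = 0"
  shows "f = 0"
proof -
  have supp: "\<And>T. f T \<noteq> 0 \<Longrightarrow> T \<in> tabloid_of I ` arrangements I r"
    and alt: "\<And>xs q. xs \<in> arrangements I r \<Longrightarrow> q permutes set xs \<Longrightarrow>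
        f (tabloid_of I (map q xs)) = of_int (sign q) * f (tabloid_of I xs)"
    and bd: "\<And>zs. Suc (length zs) = r \<Longrightarrow> distinct zs \<Longrightarrow> set zs \<subseteq> I \<Longrightarrow>
        (\<Sum>a\<in>I - set zs. f (tabloid_of I (a # zs))) = 0"
    using f by (auto simp: alternating_cycles_def)
  have off: "f (tabloid_of I xs) = 0" if "xs \<in> arrangements I r" "v \<notin> set xs" for xs
  proof -
    have S: "set xs \<subseteq> I - {v}" "card (set xs) = r"
      using that by (auto simp: arrangements_def distinct_card)
    note LS = L[OF S]
    obtain q where q: "q permutes set (L (set xs))" "map q (L (set xs)) = xs"
      using exists_permutation_map[of "L (set xs)" xs] LS \<open>xs \<in> arrangements I r\<close>
      by (auto simp: arrangements_def)
    have "L (set xs) \<in> arrangements I r"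
      using LS S by (auto simp: arrangements_def dest: distinct_card)
    from alt[OF this q(1)] q(2) zero[OF S] show ?thesis by simp
  qed
  have on: "f (tabloid_of I xs) = 0" if xs: "xs \<in> arrangements I r" "v \<in> set xs" for xs
  proof -
    define zs where "zs = remove1 v xs"
    have zs: "distinct (v # zs)" "set (v # zs) = set xs" "Suc (length zs) = r" "set (v # zs) \<subseteq> I"
      using xs by (auto simp: zs_def arrangements_def length_remove1 dest: length_pos_if_in_set)
    have "(\<Sum>a\<in>I - set zs. f (tabloid_of I (a # zs))) = f (tabloid_of I (v # zs))"
    proof (subst sum.mono_neutral_right[of "I - set zs" "{v}"])
      show "\<forall>a\<in>I - set zs - {v}. f (tabloid_of I (a # zs)) = 0"
        using zs by (intro ballI off) (auto simp: arrangements_def)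
    qed (use fin v zs in auto)
    then have "f (tabloid_of I (v # zs)) = 0" using bd[of zs] zs by auto
    moreover obtain q where "q permutes set (v # zs)" "map q (v # zs) = xs"
      using exists_permutation_map[of "v # zs" xs] zs xs by (auto simp: arrangements_def)
    ultimately show ?thesis
      using alt[of "v # zs" q] zs by (auto simp: arrangements_def)
  qed
  have "f T = 0" for T
    using supp[of T] off on by blast
  then show ?thesis by (simp add: fun_eq_iff)
qed

section \<open>The group action and the hook character\<close>

lemma permutes_conjugate:
  assumes "bij \<sigma>" "q permutes A"
  shows "\<sigma> \<circ> q \<circ> inv \<sigma> permutes \<sigma> ` A"
proof (rule bij_imp_permutes)
  have "bij_betw (inv \<sigma>) (\<sigma> ` A) A"
    using assms(1) by (simp add: bij_betw_def bij_is_inj image_inv_f_f bij_imp_bij_inv inj_on_inv_into)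
  moreover have "bij_betw \<sigma> A (\<sigma> ` A)"
    using assms(1) by (auto simp: bij_betw_def intro: inj_on_subset)
  ultimately show "bij_betw (\<sigma> \<circ> q \<circ> inv \<sigma>) (\<sigma> ` A) (\<sigma> ` A)"
    using permutes_imp_bij[OF assms(2)] by (intro bij_betw_trans)
  fix x assume "x \<notin> \<sigma> ` A"
  then have "inv \<sigma> x \<notin> A" using assms(1) by (metis bij_inv_eq_iff image_eqI)
  then show "(\<sigma> \<circ> q \<circ> inv \<sigma>) x = x"
    using permutes_not_in[OF assms(2)] assms(1) by (simp add: bij_is_surj surj_f_inv_f)
qed

text \<open>Conjugation by \<open>\<sigma>\<close> carries the symmetric group of the first column
  to that of its image and preserves signs.\<close>

lemma perm_action_hook_polytabloid:
  assumes fin: "finite I" and \<sigma>: "\<sigma> permutes I"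
  shows "perm_action \<sigma> (hook_polytabloid I a ys) = hook_polytabloid I (\<sigma> a) (map \<sigma> ys)"
proof
  fix T
  let ?A = "insert a (set ys)"
  have bij: "bij \<sigma>" and inj: "inj \<sigma>" and surj: "surj \<sigma>"
    using \<sigma> by (auto simp: permutes_bij permutes_inj permutes_surj)
  have perm: "permutation \<sigma>" using \<sigma> fin by (auto intro: permutes_imp_permutation)
  have move: "tabloid_of I (map q ys) = (\<lambda>r. inv \<sigma> ` T r) \<longleftrightarrow> tabloid_of I (map (\<sigma> \<circ> q) ys) = T" for q
  proof -
    have "tabloid_of I (map q ys) = (\<lambda>r. inv \<sigma> ` T r) \<longleftrightarrow>
        (\<lambda>r. \<sigma> ` tabloid_of I (map q ys) r) = (\<lambda>r. \<sigma> ` inv \<sigma> ` T r)"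
      using inj by (simp add: fun_eq_iff inj_image_eq_iff)
    then show ?thesis
      by (simp add: tabloid_of_image[OF \<sigma>] image_f_inv_f[OF surj])
  qed
  let ?c = "\<lambda>q. \<sigma> \<circ> q \<circ> inv \<sigma>"
  have bijc: "bij_betw ?c {q. q permutes ?A} {q. q permutes \<sigma> ` ?A}"
  proof (rule bij_betw_byWitness[where f' = "\<lambda>q. inv \<sigma> \<circ> q \<circ> \<sigma>"])
    have "inv \<sigma> \<circ> q \<circ> \<sigma> permutes ?A" if "q permutes \<sigma> ` ?A" for q
      using permutes_conjugate[OF bij_imp_bij_inv[OF bij] that] bij
      by (simp add: inv_inv_eq image_inv_f_f[OF inj] inj)
    then show "(\<lambda>q. inv \<sigma> \<circ> q \<circ> \<sigma>) ` {q. q permutes \<sigma> ` ?A} \<subseteq> {q. q permutes ?A}" by auto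
    show "?c ` {q. q permutes ?A} \<subseteq> {q. q permutes \<sigma> ` ?A}"
      using permutes_conjugate[OF bij] by blast
  qed (simp_all add: fun_eq_iff inj surj_f_inv_f[OF surj])
  have "perm_action \<sigma> (hook_polytabloid I a ys) T =
     (\<Sum>q | q permutes ?A. of_int (sign q) * (if tabloid_of I (map (\<sigma> \<circ> q) ys) = T then 1 else 0))"
    by (simp add: perm_action_def hook_polytabloid_def move)
  also have "\<dots> = (\<Sum>q | q permutes ?A. of_int (sign (?c q)) *
      (if tabloid_of I (map (?c q) (map \<sigma> ys)) = T then 1 else 0))"
  proof (rule sum.cong[OF refl])
    fix q assume "q \<in> {q. q permutes ?A}"
    then have "permutation q" using permutes_imp_permutation[of ?A q] by simp
    then have "sign (?c q) = sign q"
      using perm by (simp add: sign_compose sign_inverse permutation_compose permutation_inverse)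
    moreover have "map (?c q) (map \<sigma> ys) = map (\<sigma> \<circ> q) ys"
      using inj by simp
    ultimately show "of_int (sign q) * (if tabloid_of I (map (\<sigma> \<circ> q) ys) = T then 1 else 0 :: real) =
        of_int (sign (?c q)) * (if tabloid_of I (map (?c q) (map \<sigma> ys)) = T then 1 else 0)"
      by metis
  qed
  also have "\<dots> = (\<Sum>q | q permutes \<sigma> ` ?A. of_int (sign q) *
      (if tabloid_of I (map q (map \<sigma> ys)) = T then 1 else 0))"
    by (rule sum.reindex_bij_betw[OF bijc])
  finally show "perm_action \<sigma> (hook_polytabloid I a ys) T = hook_polytabloid I (\<sigma> a) (map \<sigma> ys) T"
    by (simp add: hook_polytabloid_def)
qed

lemma linear_perm_action: "Vector_Spaces.linear scale_fun scale_fun (perm_action \<sigma>)"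
  by unfold_locales (auto simp: perm_action_def scale_fun_def fun_eq_iff algebra_simps)

text \<open>With \<open>\<tau>\<close> the inverse of \<open>\<sigma>\<close>, this is the value at \<open>\<sigma>\<close> of the character of shape
  \<open>(j, 1^(card I - j))\<close>; an integer \<open>j\<close> outside \<open>1, \<dots>, card I\<close> gives the empty sum.\<close>

definition hook_char :: "'v set \<Rightarrow> 'v \<Rightarrow> int \<Rightarrow> ('v \<Rightarrow> 'v) \<Rightarrow> real" where
  "hook_char I v j \<tau> =
     (\<Sum>S | S \<subseteq> I - {v} \<and> int (card S) = int (card I) - j.
        \<Sum>q | q permutes insert v S \<and> (\<forall>s\<in>S. q s = \<tau> s). of_int (sign q))"

text \<open>The diagonal coefficient at \<open>S\<close> is the coefficient of the cone over
  \<open>S\<close> at the arrangement \<open>L S\<close> moved by \<open>inv \<sigma>\<close>. It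
  counts, with sign, the permutations of the cone's points that act on \<open>S\<close> as
  \<open>inv \<sigma>\<close> does; the inverse stems from the action on coefficient functions being
  a precomposition.\<close>

lemma irr_character_hook:
  assumes fin: "finite I" and v: "v \<in> I" and j: "1 \<le> j" "j \<le> card I" and \<sigma>: "\<sigma> permutes I"
  shows "irr_character (hook_partition (card I) j) I \<sigma> = hook_char I v (int j) (inv \<sigma>)"
proof -
  define r where "r = card I - j"
  define W where "W = specht_module (hook_partition (card I) j) I"
  define P where "P = {S. S \<subseteq> I - {v} \<and> card S = r}"
  \<comment> \<open>Any ordering of each set will do: the same list serves as the leg and as the
    place of evaluation, so the choice disappears from the diagonal coefficients.\<close>
  define L where "L = (\<lambda>S::'a set. SOME xs. distinct xs \<and> set xs = S)"
  have L: "distinct (L S)" "set (L S) = S" if "S \<subseteq> I" for S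
  proof -
    have "\<exists>xs. distinct xs \<and> set xs = S"
      using finite_distinct_list[of S] finite_subset[OF that fin] by blast
    then have "distinct (L S) \<and> set (L S) = S" unfolding L_def by (rule someI_ex)
    then show "distinct (L S)" "set (L S) = S" by auto
  qed
  have lenL: "length (L S) = r" if "S \<in> P" for S
    using that L[of S] distinct_card[of "L S"] unfolding P_def by fastforce
  have subW: "fun_space.subspace W" by (simp add: W_def specht_module_def fun_space.subspace_span)
  have poly_W: "hook_polytabloid I a xs \<in> W"
    if xs: "distinct (a # xs)" "set (a # xs) \<subseteq> I" "length xs = r" for a xs
  proof -
    obtain t where "t \<in> tableaux (hook_partition (card I) j) I" "t (0, 0) = a" "hook_leg r t = xs"
      using hook_tableau_exists[OF fin j xs(1,2)] xs(3) by (auto simp: r_def)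
    then have "hook_polytabloid I a xs = polytabloid (hook_partition (card I) j) I t"
      using polytabloid_hook[OF j(1), of t "card I" I] by (simp add: r_def)
    then show ?thesis
      using \<open>t \<in> _\<close> by (auto simp: W_def specht_module_def intro: fun_space.span_base)
  qed
  have tab: "\<exists>a xs. distinct (a # xs) \<and> set (a # xs) \<subseteq> I \<and> length xs = r \<and>
      polytabloid (hook_partition (card I) j) I t = hook_polytabloid I a xs"
    if "t \<in> tableaux (hook_partition (card I) j) I" for t
    using hook_tableau_leg(1,2)[OF j(1) that] polytabloid_hook[OF j(1) that]
    by (intro exI[of _ "t (0,0)"] exI[of _ "hook_leg r t"]) (simp add: r_def hook_leg_def)
  have W_sub: "W \<subseteq> alternating_cycles I r"
    unfolding W_def specht_module_def
  proof (rule fun_space.span_minimal[OF _ subspace_alternating_cycles])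
    show "polytabloid (hook_partition (card I) j) I ` tableaux (hook_partition (card I) j) I
        \<subseteq> alternating_cycles I r"
    proof clarify
      fix t assume "t \<in> tableaux (hook_partition (card I) j) I"
      then obtain a xs where "distinct (a # xs)" "set (a # xs) \<subseteq> I" "length xs = r"
        "polytabloid (hook_partition (card I) j) I t = hook_polytabloid I a xs" using tab by blast
      then show "polytabloid (hook_partition (card I) j) I t \<in> alternating_cycles I r"
        using hook_polytabloid_mem[OF fin] by metis
    qed
  qed
  have stable: "perm_action \<sigma> ` W \<subseteq> W"
  proof -
    interpret l: Vector_Spaces.linear scale_fun scale_fun "perm_action \<sigma>"
      by (rule linear_perm_action)
    have "perm_action \<sigma> ` polytabloid (hook_partition (card I) j) I ` tableaux (hook_partition (card I) j) I \<subseteq> W"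
    proof clarify
      fix t assume "t \<in> tableaux (hook_partition (card I) j) I"
      then obtain a xs where *: "distinct (a # xs)" "set (a # xs) \<subseteq> I" "length xs = r"
        "polytabloid (hook_partition (card I) j) I t = hook_polytabloid I a xs" using tab by blast
      have "hook_polytabloid I (\<sigma> a) (map \<sigma> xs) \<in> W"
      proof (rule poly_W)
        show "distinct (\<sigma> a # map \<sigma> xs)"
          using *(1) permutes_inj[OF \<sigma>] by (auto simp: distinct_map inj_def inj_on_def)
        show "set (\<sigma> a # map \<sigma> xs) \<subseteq> I" using image_mono[OF *(2), of \<sigma>] by (simp add: permutes_image[OF \<sigma>])
      qed (use * in simp)
      then show "perm_action \<sigma> (polytabloid (hook_partition (card I) j) I t) \<in> W"
        by (simp add: * perm_action_hook_polytabloid[OF fin \<sigma>])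
    qed
    then have "fun_space.span (perm_action \<sigma> ` polytabloid (hook_partition (card I) j) I ` tableaux (hook_partition (card I) j) I) \<subseteq> W"
      using subW by (rule fun_space.span_minimal)
    then show ?thesis by (simp add: W_def specht_module_def l.span_image)
  qed
  have g: "hook_polytabloid I v (L S) \<in> W" if "S \<in> P" for S
    using that L[of S] lenL[OF that] v by (intro poly_W) (auto simp: P_def)
  have finP: "finite P" unfolding P_def using fin by (auto intro: finite_subset[of _ "Pow I"])
  have coord: "hook_polytabloid I v (L S) (tabloid_of I (L S')) = (if S = S' then 1 else 0)"
    if SS: "S \<in> P" "S' \<in> P" for S S'
  proof -
    have S: "S \<subseteq> I" "v \<notin> S" and S': "S' \<subseteq> I" "v \<notin> S'" using that by (auto simp: P_def)
    \<comment> \<open>The image \<open>S'\<close> of \<open>S\<close> avoids \<open>v\<close>, so it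
      lies in \<open>S\<close> and equals it by cardinality. Equality of the two lists then makes
      \<open>q\<close> fix \<open>S\<close> pointwise, and \<open>v\<close> has nowhere else to
      go.\<close>
    have key: "q = id \<and> S = S'" if q: "q permutes insert v (set (L S))" "map q (L S) = L S'" for q
    proof -
      have qS: "q ` S = S'" using q(2) L[OF S(1)] L[OF S'(1)] by (metis list.set_map)
      have "q v \<notin> S'" using qS S(2) permutes_inj[OF q(1)] by (auto simp: inj_def)
      have "q ` insert v S = insert v S" using permutes_image[OF q(1)] L(2)[OF S(1)] by metis
      then have "S' \<subseteq> insert v S" using qS by (metis image_insert subset_insertI)
      then have sub: "S' \<subseteq> S" using S'(2) by blast
      have "S = S'" using card_subset_eq[OF finite_subset[OF S(1) fin] sub] SS by (simp add: P_def)
      moreover have "q s = s" if "s \<in> S" for s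
        using that q(2) \<open>S = S'\<close> L(2)[OF S(1)] by (metis map_eq_conv map_ident)
      moreover have "q v = v"
        using \<open>q v \<notin> S'\<close> \<open>S = S'\<close> permutes_in_image[OF q(1), of v] L(2)[OF S(1)] by auto
      ultimately have "q x = x" for x
        using permutes_not_in[OF q(1), of x] L(2)[OF S(1)] by (cases "x \<in> insert v S") auto
      then show ?thesis using \<open>S = S'\<close> by auto
    qed
    have "hook_polytabloid I v (L S) (tabloid_of I (L S')) =
      (\<Sum>q | q permutes insert v (set (L S)). of_int (sign q) * (if map q (L S) = L S' then 1 else 0))"
      using lenL SS by (intro hook_polytabloid_apply) simp
    also have "\<dots> = (\<Sum>q | q permutes insert v (set (L S)). if q = id then (if S = S' then 1 else 0) else 0)"
      using key by (intro sum.cong refl) auto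
    also have "\<dots> = (if S = S' then 1 else 0)"
      by (subst sum.delta) (auto simp: finite_permutations)
    finally show ?thesis .
  qed
  have sum_app: "(\<Sum>i\<in>A. h i) a = (\<Sum>i\<in>A. h i a)" for h :: "'j \<Rightarrow> 'b \<Rightarrow> real" and A a
    by (induction A rule: infinite_finite_induct) auto
  have expand: "w = (\<Sum>S\<in>P. scale_fun (w (tabloid_of I (L S))) (hook_polytabloid I v (L S)))" (is "w = ?e")
    if w: "w \<in> W" for w
  proof -
    \<comment> \<open>The difference between \<open>w\<close> and the proposed expansion is an
      alternating cycle whose coordinates at all \<open>L S\<close> vanish.\<close>
    have "?e \<in> W" using subW g by (intro fun_space.subspace_sum fun_space.subspace_scale)
    then have "w - ?e \<in> alternating_cycles I r"
      using fun_space.subspace_diff[OF subW w] W_sub by blast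
    then have "w - ?e = 0"
    proof (rule alternating_cycles_eq_zero[OF fin _ v, where L = L])
      fix S assume S: "S \<subseteq> I - {v}" "card S = r"
      then show "distinct (L S) \<and> set (L S) = S" using L[of S] by auto
      have "?e (tabloid_of I (L S)) =
          (\<Sum>S'\<in>P. w (tabloid_of I (L S')) * (if S' = S then 1 else 0))"
        unfolding sum_app scale_fun_def using S by (intro sum.cong refl) (simp add: coord P_def)
      also have "\<dots> = w (tabloid_of I (L S))"
        using S finP by (simp add: P_def if_distrib cong: if_cong)
      finally show "(w - ?e) (tabloid_of I (L S)) = 0" by simp
    qed
    then show ?thesis by simp
  qed
  have "irr_character (hook_partition (card I) j) I \<sigma> =
      (\<Sum>S\<in>P. perm_action \<sigma> (hook_polytabloid I v (L S)) (tabloid_of I (L S)))"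
    unfolding irr_character_def W_def[symmetric]
    by (rule trace_on_eq_sum[OF finP subW g expand linear_perm_action stable])
  also have "\<dots> = (\<Sum>S\<in>P. \<Sum>q | q permutes insert v S \<and> (\<forall>s\<in>S. q s = inv \<sigma> s). of_int (sign q))"
  proof (rule sum.cong[OF refl])
    fix S assume "S \<in> P"
    then have S: "S \<subseteq> I" by (auto simp: P_def)
    have "perm_action \<sigma> (hook_polytabloid I v (L S)) (tabloid_of I (L S)) =
        hook_polytabloid I v (L S) (tabloid_of I (map (inv \<sigma>) (L S)))"
      by (simp add: perm_action_def tabloid_of_image[OF permutes_inv[OF \<sigma>]])
    also have "\<dots> = (\<Sum>q | q permutes insert v S.
        of_int (sign q) * (if map q (L S) = map (inv \<sigma>) (L S) then 1 else 0))"
      by (subst hook_polytabloid_apply) (simp_all add: L[OF S])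
    also have "\<dots> = (\<Sum>q | q permutes insert v S. if \<forall>s\<in>S. q s = inv \<sigma> s then of_int (sign q) else 0)"
      by (intro sum.cong refl) (simp add: L[OF S])
    also have "\<dots> = (\<Sum>q | q permutes insert v S \<and> (\<forall>s\<in>S. q s = inv \<sigma> s). of_int (sign q))"
      using finite_permutations[of "insert v S"] finite_subset[OF S fin]
      by (simp add: sum.inter_filter[symmetric])
    finally show "perm_action \<sigma> (hook_polytabloid I v (L S)) (tabloid_of I (L S)) = \<dots>" .
  qed
  also have "\<dots> = hook_char I v (int j) (inv \<sigma>)"
    unfolding hook_char_def P_def r_def using j
    by (intro sum.cong refl) (auto simp: of_nat_diff)
  finally show ?thesis .
qed

section \<open>Removing a cycle from a permutation\<close>

text \<open>Absorbs the case distinctions of \<open>hook_immanant\<close>, so that an immanant is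
  one sum over permutations for all \<open>I\<close> and \<open>j\<close>. On the empty set this sum
  has a single term, the identity with the empty product.\<close>

definition hook_weight :: "'v set \<Rightarrow> int \<Rightarrow> ('v \<Rightarrow> 'v) \<Rightarrow> real" where
  "hook_weight I j \<sigma> =
     (if I = {} then (if j \<le> 0 then (-1) ^ nat (- j) else 0)
      else if 1 \<le> j \<and> j \<le> int (card I) then irr_character (hook_partition (card I) (nat j)) I \<sigma>
      else 0)"

lemma hook_immanant_eq_sum:
  "hook_immanant I j M = (\<Sum>\<sigma> | \<sigma> permutes I. hook_weight I j \<sigma> * (\<Prod>i\<in>I. M i (\<sigma> i)))"
  by (auto simp: hook_immanant_def hook_weight_def)

text \<open>A subset of \<open>I - {v}\<close> has between 0 and \<open>card I - 1\<close> elements,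
  so outside the range of \<open>j\<close> the sum is empty and agrees with the default value
  0.\<close>

lemma hook_weight_eq_hook_char:
  assumes fin: "finite I" and v: "v \<in> I" and \<sigma>: "\<sigma> permutes I"
  shows "hook_weight I j \<sigma> = hook_char I v j (inv \<sigma>)"
proof (cases "1 \<le> j \<and> j \<le> int (card I)")
  case True
  then show ?thesis
    using irr_character_hook[OF fin v _ _ \<sigma>, of "nat j"] v unfolding hook_weight_def by fastforce
next
  case False
  have "int (card S) \<noteq> int (card I) - j" if "S \<subseteq> I - {v}" for S
  proof -
    have "card S < card I" using that v fin by (intro psubset_card_mono) auto
    then show ?thesis using False by linarith
  qed
  then have none: "{S. S \<subseteq> I - {v} \<and> int (card S) = int (card I) - j} = {}"
    by blast
  show ?thesis
    unfolding hook_char_def none using False v by (auto simp: hook_weight_def)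
qed

section \<open>Cyclic permutations given by lists\<close>

lemma cycle_of_list_nth:
  assumes "distinct ws" "i < length ws"
  shows "cycle_of_list ws (ws ! i) = ws ! (Suc i mod length ws)"
proof -
  have "cycle_of_list ws (ws ! i) = map (cycle_of_list ws ^^ 1) ws ! i"
    using assms by simp
  also have "\<dots> = rotate 1 ws ! i" by (simp only: cyclic_rotation[OF assms(1)])
  also have "\<dots> = ws ! (Suc i mod length ws)"
    using assms(2) by (simp add: nth_rotate1)
  finally show ?thesis .
qed

lemma sign_cycle_of_list:
  "distinct ws \<Longrightarrow> ws \<noteq> [] \<Longrightarrow> sign (cycle_of_list ws) = (-1) ^ (length ws + 1)"
  by (induction ws rule: cycle_of_list.induct)
     (auto simp: sign_compose permutation_swap_id permutation_of_cycle sign_swap_id)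

text \<open>An injective self-map of a finite set is onto, so closure under backward steps of the
  cycle gives closure under forward steps, and these reach every entry.\<close>

lemma inv_cycle_closed:
  assumes "distinct ws" "x \<in> A" "x \<in> set ws"
    and closed: "\<And>y. y \<in> A \<Longrightarrow> y \<in> set ws \<Longrightarrow> inv (cycle_of_list ws) y \<in> A"
  shows "set ws \<subseteq> A"
proof -
  let ?c = "cycle_of_list ws" and ?B = "A \<inter> set ws"
  have c: "?c permutes set ws" by (rule cycle_permutes)
  have "inv ?c ` ?B \<subseteq> ?B"
    using closed permutes_in_image[OF permutes_inv[OF c]] by auto
  moreover have "inj_on (inv ?c) ?B" by (rule permutes_inj_on[OF permutes_inv[OF c]])
  ultimately have eq: "inv ?c ` ?B = ?B" by (intro endo_inj_surj) auto
  have step: "?c y \<in> ?B" if "y \<in> ?B" for y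
  proof -
    obtain z where "z \<in> ?B" "y = inv ?c z" using eq \<open>y \<in> ?B\<close> by (metis imageE)
    then show ?thesis by (simp add: permutes_inverses[OF c])
  qed
  obtain i where i: "i < length ws" "x = ws ! i" using assms(3) by (auto simp: in_set_conv_nth)
  have "ws ! ((i + n) mod length ws) \<in> ?B" for n
  proof (induction n)
    case 0
    then show ?case using i assms(2) by simp
  next
    case (Suc n)
    have "(i + n) mod length ws < length ws" using i by (intro mod_less_divisor) auto
    from step[OF Suc] cycle_of_list_nth[OF assms(1) this] show ?case by (simp add: mod_Suc_eq)
  qed
  note all = this
  show ?thesis
  proof
    fix y assume "y \<in> set ws"
    then obtain k where "k < length ws" "y = ws ! k" by (auto simp: in_set_conv_nth)
    \<comment> \<open>Starting at \<open>i\<close>, this many forward steps end at index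
      \<open>k + length ws\<close>, which is \<open>k\<close> modulo the length.\<close>
    then show "y \<in> A" using all[of "k + (length ws - i)"] i by auto
  qed
qed

lemma lower_set_nat_eq:
  fixes A :: "nat set"
  assumes "finite A" "\<And>i. Suc i \<in> A \<Longrightarrow> i \<in> A"
  shows "A = {..<card A}"
proof (cases "A = {}")
  case False
  have dn: "k \<le> i \<Longrightarrow> i \<in> A \<Longrightarrow> k \<in> A" for i k
    by (induction i) (use assms(2) le_Suc_eq in auto)
  have "A = {..Max A}"
    using dn[OF _ Max_in[OF assms(1) False]] assms(1) by auto
  then have "A = {..<Suc (Max A)}" by (simp add: lessThan_Suc_atMost)
  then show ?thesis by (metis card_lessThan)
qed simp

text \<open>A permutation fixing all points but one fixes that one as well. It follows that an inner
  sum of \<open>hook_char\<close> has at most one term.\<close>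

lemma permutes_eqI:
  assumes "p permutes insert v S" "q permutes insert v S" "\<And>s. s \<in> S \<Longrightarrow> p s = q s"
  shows "p = q"
proof -
  have "inv q \<circ> p permutes insert v S"
    using assms by (intro permutes_compose permutes_inv)
  moreover have "(inv q \<circ> p) x = x" if "x \<in> insert v S - {v}" for x
    using that assms(3) permutes_inverses(2)[OF assms(2)] by auto
  ultimately have "inv q \<circ> p permutes {v}" by (rule permutes_superset)
  then have "inv q (p x) = x" for x by (simp add: fun_eq_iff)
  then show ?thesis using permutes_inverses(1)[OF assms(2)] by (metis ext)
qed

text \<open>With the first entry as apex, exactly one \<open>S\<close> contributes: the
  \<open>r\<close> entries after it, where \<open>r\<close> is the leg length \<open>n - j\<close>.
  The matching \<open>q\<close> is the inverse cycle on the apex and these entries, so the value is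
  the sign of an \<open>(r + 1)\<close>-cycle.\<close>

lemma hook_char_full_cycle:
  assumes ws: "distinct ws" "ws \<noteq> []" and j: "1 \<le> j" "j \<le> int (length ws)"
  shows "hook_char (set ws) (hd ws) j (inv (cycle_of_list ws)) = (-1) ^ nat (int (length ws) - j)"
proof -
  define n where "n = length ws"
  define r where "r = nat (int n - j)"
  have r: "r < n" using j by (auto simp: r_def n_def)
  let ?c = "cycle_of_list ws" and ?v = "hd ws"
  have v: "?v = ws ! 0" using ws by (simp add: hd_conv_nth)
  \<comment> \<open>The apex belongs to \<open>D\<close>, hence one entry more than the leg
    length.\<close>
  define D where "D = take (Suc r) ws"
  define q0 where "q0 = inv (cycle_of_list D)"
  have D: "distinct D" "length D = Suc r" using ws r by (auto simp: D_def n_def)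
  have Dnth: "D ! i = ws ! i" if "i \<le> r" for i using that by (simp add: D_def)
  have vD: "?v \<in> set D" using nth_mem[of 0 D] D Dnth[of 0] v by simp
  have inv_c: "inv ?c (ws ! Suc i) = ws ! i" if "Suc i < n" for i
    using cycle_of_list_nth[OF ws(1), of i] that permutes_inverses(2)[OF cycle_permutes[of ws]]
    by (metis n_def Suc_lessD mod_less)
  have inv_D: "q0 (ws ! Suc i) = ws ! i" if "Suc i \<le> r" for i
    using cycle_of_list_nth[OF D(1), of i] that permutes_inverses(2)[OF cycle_permutes[of D]] D(2) Dnth
    unfolding q0_def by (metis Suc_leD le_imp_less_Suc mod_less)
  have q0: "q0 permutes set D" unfolding q0_def by (intro permutes_inv cycle_permutes)
  define S0 where "S0 = set D - {?v}"
  have ins: "insert ?v S0 = set D" using vD by (auto simp: S0_def)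
  have S0: "\<exists>i. s = ws ! Suc i \<and> Suc i \<le> r" if s: "s \<in> S0" for s
  proof -
    obtain i where i: "i < Suc r" "s = D ! i" using s D(2) by (auto simp: S0_def in_set_conv_nth)
    then have "i \<noteq> 0" using s v Dnth[of 0] unfolding S0_def by (metis DiffE le0 singletonI)
    then obtain i' where "i = Suc i'" by (cases i) auto
    then show ?thesis using i Dnth[of i] by auto
  qed
  have agree: "q0 s = inv ?c s" if "s \<in> S0" for s
    using S0[OF that] inv_D inv_c r by force
  have cardS0: "card S0 = r" using D vD by (simp add: S0_def distinct_card)
  have uniq: "S = S0" if S: "S \<subseteq> set ws - {?v}" "card S = r"
    and q: "q permutes insert ?v S" "\<forall>s\<in>S. q s = inv ?c s" for S q
  proof -
    define K where "K = {i. i < n \<and> ws ! i \<in> insert ?v S}"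
    have img: "(!) ws ` K = insert ?v S"
    proof
      show "insert ?v S \<subseteq> (!) ws ` K"
      proof
        fix x assume x: "x \<in> insert ?v S"
        then have "x \<in> set ws" using S(1) ws(2) by auto
        then show "x \<in> (!) ws ` K" using x by (auto simp: K_def n_def in_set_conv_nth)
      qed
    qed (auto simp: K_def)
    have "inj_on ((!) ws) K" using ws by (auto simp: K_def n_def inj_on_def nth_eq_iff_index_eq)
    then have "card K = card (insert ?v S)" using card_image img by metis
    also have "\<dots> = Suc r"
      using S finite_subset[OF S(1)] by (subst card_insert_disjoint) auto
    finally have "card K = Suc r" .
    \<comment> \<open>At index \<open>i + 1\<close> the permutation \<open>q\<close> acts as the
      inverse cycle and lands on index \<open>i\<close>, which must stay in the set that
      \<open>q\<close> permutes. So the indices form an initial segment.\<close>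
    moreover have "K = {..<card K}"
    proof (rule lower_set_nat_eq)
      fix i assume i: "Suc i \<in> K"
      then have "ws ! Suc i \<noteq> ?v" using ws v by (simp add: K_def n_def nth_eq_iff_index_eq)
      then have "ws ! Suc i \<in> S" using i by (auto simp: K_def)
      then have "q (ws ! Suc i) = ws ! i" using q(2) inv_c i by (simp add: K_def)
      then have "ws ! i \<in> insert ?v S"
        using permutes_in_image[OF q(1), of "ws ! Suc i"] \<open>ws ! Suc i \<in> S\<close> by simp
      then show "i \<in> K" using i by (simp add: K_def)
    qed (simp add: K_def)
    ultimately have "insert ?v S = (!) ws ` {..<Suc r}" using img by simp
    also have "\<dots> = set D"
      using r by (simp add: D_def nth_image n_def lessThan_atLeast0)
    finally show "S = S0" using S(1) by (auto simp: S0_def)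
  qed
  let ?Q = "\<lambda>S. {q. q permutes insert ?v S \<and> (\<forall>s\<in>S. q s = inv ?c s)}"
  have Q0: "?Q S0 = {q0}"
  proof -
    have "q = q0" if "q \<in> ?Q S0" for q
      using that agree q0 by (intro permutes_eqI[of q ?v S0 q0]) (auto simp: ins)
    then show ?thesis using agree q0 by (auto simp: ins)
  qed
  have empty: "?Q S = {}" if "S \<subseteq> set ws - {?v}" "card S = r" "S \<noteq> S0" for S
    using uniq[OF that(1,2)] that(3) by blast
  have cards: "{S. S \<subseteq> set ws - {?v} \<and> int (card S) = int (card (set ws)) - j} =
      {S. S \<subseteq> set ws - {?v} \<and> card S = r}"
    using j distinct_card[OF ws(1)] by (auto simp: r_def n_def)
  have "hook_char (set ws) ?v j (inv ?c) =
      (\<Sum>S | S \<subseteq> set ws - {?v} \<and> card S = r. \<Sum>q\<in>?Q S. of_int (sign q))"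
    unfolding hook_char_def cards ..
  also have "\<dots> = (\<Sum>S | S \<subseteq> set ws - {?v} \<and> card S = r. if S = S0 then of_int (sign q0) else 0)"
  proof (intro sum.cong refl)
    fix S assume "S \<in> {S. S \<subseteq> set ws - {?v} \<and> card S = r}"
    then have "?Q S = (if S = S0 then {q0} else {})" using empty Q0 by (cases "S = S0") auto
    then show "(\<Sum>q\<in>?Q S. of_int (sign q)) = (if S = S0 then of_int (sign q0) else (0 :: real))"
      by simp
  qed
  also have "\<dots> = of_int (sign q0)"
  proof -
    have "set D \<subseteq> set ws" unfolding D_def by (rule set_take_subset)
    then have "S0 \<in> {S. S \<subseteq> set ws - {?v} \<and> card S = r}"
      using cardS0 by (auto simp: S0_def)
    moreover have "finite {S. S \<subseteq> set ws - {?v} \<and> card S = r}"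
      by (rule finite_subset[of _ "Pow (set ws)"]) auto
    ultimately show ?thesis by (subst sum.delta) auto
  qed
  also have "sign q0 = (-1) ^ r"
  proof -
    have "D \<noteq> []" using D(2) by auto
    then show ?thesis
      using D sign_cycle_of_list[OF D(1)] unfolding q0_def by (simp add: sign_inverse permutation_of_cycle)
  qed
  finally show ?thesis by (simp add: r_def n_def)
qed

text \<open>On the cycle, \<open>q\<close> must act as the inverse cycle, which never reaches the
  apex \<open>v\<close>. Thus the part of the cycle inside \<open>S\<close> is closed under it and
  is empty or everything. These two cases give the two terms on the right.\<close>

lemma hook_char_remove_cycle:
  assumes fin: "finite I" and ws: "distinct ws" "ws \<noteq> []" "set ws \<subseteq> I"
    and v: "v \<in> I - set ws" and \<sigma>: "\<sigma> permutes I - set ws"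
  shows "hook_char I v j (inv (cycle_of_list ws \<circ> \<sigma>)) =
    hook_char (I - set ws) v (j - int (length ws)) (inv \<sigma>)
    + (-1) ^ (length ws + 1) * hook_char (I - set ws) v j (inv \<sigma>)"
proof -
  let ?c = "cycle_of_list ws" and ?C = "set ws" and ?\<tau>' = "inv \<sigma>"
  let ?\<tau> = "inv (?c \<circ> \<sigma>)"
  have c: "?c permutes ?C" by (rule cycle_permutes)
  have \<tau>: "?\<tau> = ?\<tau>' \<circ> inv ?c"
    using permutes_bij[OF c] permutes_bij[OF \<sigma>] by (rule o_inv_distrib)
  have \<tau>C: "?\<tau> s = inv ?c s" if "s \<in> ?C" for s
  proof -
    have "inv ?c s \<in> ?C" using permutes_in_image[OF permutes_inv[OF c]] that by blast
    then show ?thesis using permutes_not_in[OF permutes_inv[OF \<sigma>]] by (simp add: \<tau>)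
  qed
  have \<tau>N: "?\<tau> s = ?\<tau>' s" if "s \<notin> ?C" for s
    using permutes_not_in[OF permutes_inv[OF c] that] by (simp add: \<tau>)
  have \<tau>'N: "?\<tau>' s \<notin> ?C" if "s \<in> I - ?C" for s
    using permutes_in_image[OF permutes_inv[OF \<sigma>]] that by blast
  define Q where "Q = (\<lambda>S. {q. q permutes insert v S \<and> (\<forall>s\<in>S. q s = ?\<tau> s)})"
  define Q' where "Q' = (\<lambda>S. {q. q permutes insert v S \<and> (\<forall>s\<in>S. q s = ?\<tau>' s)})"
  define F where "F = (\<lambda>S. \<Sum>q\<in>Q S. of_int (sign q) :: real)"
  define F' where "F' = (\<lambda>S. \<Sum>q\<in>Q' S. of_int (sign q) :: real)"
  define P where "P = {S. S \<subseteq> I - {v} \<and> int (card S) = int (card I) - j}"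
  have finP: "finite P" unfolding P_def using fin by (auto intro: finite_subset[of _ "Pow I"])
  have cardC: "card ?C = length ws" using ws by (simp add: distinct_card)
  have cardI: "card I = card (I - ?C) + length ws"
    using card_Diff_subset[of ?C I] card_mono[OF fin ws(3)] ws(3) cardC by auto
  have mixed: "F S = 0" if S: "S \<in> P" "S \<inter> ?C \<noteq> {}" "\<not> ?C \<subseteq> S" for S
  proof -
    have "Q S = {}"
    proof (rule ccontr)
      assume "Q S \<noteq> {}"
      then obtain q where q: "q permutes insert v S" "\<And>s. s \<in> S \<Longrightarrow> q s = ?\<tau> s" by (auto simp: Q_def)
      obtain x where x: "x \<in> S" "x \<in> ?C" using S by blast
      have "?C \<subseteq> S"
      proof (rule inv_cycle_closed[OF ws(1) x])
        fix y assume y: "y \<in> S" "y \<in> ?C"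
        then have "q y = inv ?c y" using q(2) \<tau>C by simp
        moreover have "inv ?c y \<noteq> v"
          using v y permutes_in_image[OF permutes_inv[OF c], of y] by auto
        ultimately show "inv ?c y \<in> S" using permutes_in_image[OF q(1), of y] y by auto
      qed
      then show False using S by blast
    qed
    then show ?thesis by (simp add: F_def)
  qed
  have disj: "F S = F' S" if "S \<inter> ?C = {}" for S
  proof -
    have "Q S = Q' S" using that \<tau>N by (auto simp: Q_def Q'_def disjoint_iff)
    then show ?thesis by (simp add: F_def F'_def)
  qed
  have full: "F (?C \<union> S) = (-1) ^ (length ws + 1) * F' S" if S: "S \<subseteq> I - ?C - {v}" for S
  proof -
    have finS: "finite S" using S fin by (meson finite_Diff finite_subset)
    \<comment> \<open>Composition with the cycle strips off the forced part of \<open>q\<close>,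
      leaves a permutation of \<open>insert v S\<close> and multiplies the sign by that of the
      cycle.\<close>
    have "bij_betw (\<lambda>q. inv ?c \<circ> q) (Q' S) (Q (?C \<union> S))"
    proof (rule bij_betw_byWitness[where f' = "\<lambda>q. ?c \<circ> q"])
      show "(\<lambda>q. inv ?c \<circ> q) ` Q' S \<subseteq> Q (?C \<union> S)"
      proof clarify
        fix q assume "q \<in> Q' S"
        then have q: "q permutes insert v S" "\<And>s. s \<in> S \<Longrightarrow> q s = ?\<tau>' s" by (auto simp: Q'_def)
        have "inv ?c \<circ> q permutes insert v (?C \<union> S)"
          by (intro permutes_compose permutes_subset[OF q(1)] permutes_subset[OF permutes_inv[OF c]]) auto
        moreover have "(inv ?c \<circ> q) s = ?\<tau> s" if "s \<in> ?C" for s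
        proof -
          have "s \<notin> insert v S" using that S v by auto
          then show ?thesis using permutes_not_in[OF q(1)] \<tau>C[OF that] by simp
        qed
        moreover have "(inv ?c \<circ> q) s = ?\<tau> s" if "s \<in> S" for s
          using that S q(2) \<tau>N[of s] \<tau>'N[of s] permutes_not_in[OF permutes_inv[OF c], of "?\<tau>' s"] by auto
        ultimately show "inv ?c \<circ> q \<in> Q (?C \<union> S)" by (auto simp: Q_def)
      qed
      show "(\<lambda>q. ?c \<circ> q) ` Q (?C \<union> S) \<subseteq> Q' S"
      proof clarify
        fix q assume "q \<in> Q (?C \<union> S)"
        then have q: "q permutes insert v (?C \<union> S)" "\<And>s. s \<in> ?C \<union> S \<Longrightarrow> q s = ?\<tau> s" by (auto simp: Q_def)
        have "?c \<circ> q permutes insert v (?C \<union> S)"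
          by (intro permutes_compose q(1) permutes_subset[OF c]) auto
        moreover have "(?c \<circ> q) s = s" if "s \<in> ?C" for s
          using that q(2)[of s] \<tau>C[OF that] permutes_inverses(1)[OF c] by simp
        ultimately have "?c \<circ> q permutes insert v S"
          by (rule permutes_superset) auto
        moreover have "(?c \<circ> q) s = ?\<tau>' s" if "s \<in> S" for s
          using that S q(2)[of s] \<tau>N[of s] \<tau>'N[of s] permutes_not_in[OF c, of "?\<tau>' s"] by auto
        ultimately show "?c \<circ> q \<in> Q' S" by (auto simp: Q'_def)
      qed
    qed (simp_all add: fun_eq_iff permutes_inverses[OF c])
    then have "F (?C \<union> S) = (\<Sum>q\<in>Q' S. of_int (sign (inv ?c \<circ> q)))"
      unfolding F_def by (rule sum.reindex_bij_betw[symmetric])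
    also have "\<dots> = (\<Sum>q\<in>Q' S. (-1) ^ (length ws + 1) * of_int (sign q))"
    proof (rule sum.cong[OF refl])
      fix q assume "q \<in> Q' S"
      then have "permutation q"
        using finS permutes_imp_permutation[of "insert v S" q] by (simp add: Q'_def)
      then show "of_int (sign (inv ?c \<circ> q)) = (-1) ^ (length ws + 1) * (of_int (sign q) :: real)"
        using ws by (simp add: sign_compose permutation_inverse permutation_of_cycle sign_inverse sign_cycle_of_list)
    qed
    finally show ?thesis by (simp add: F'_def sum_distrib_left)
  qed
  have "hook_char I v j ?\<tau> = (\<Sum>S\<in>P. F S)"
    by (simp add: hook_char_def P_def F_def Q_def)
  also have "\<dots> = (\<Sum>S\<in>{S\<in>P. S \<inter> ?C = {}} \<union> {S\<in>P. ?C \<subseteq> S}. F S)"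
    using finP mixed by (intro sum.mono_neutral_right) auto
  also have "\<dots> = (\<Sum>S\<in>{S\<in>P. S \<inter> ?C = {}}. F S) + (\<Sum>S\<in>{S\<in>P. ?C \<subseteq> S}. F S)"
    using finP ws(2) by (intro sum.union_disjoint) (auto simp: disjoint_iff, metis last_in_set subsetD)
  also have "(\<Sum>S\<in>{S\<in>P. S \<inter> ?C = {}}. F S) = hook_char (I - ?C) v (j - int (length ws)) ?\<tau>'"
  proof -
    \<comment> \<open>Here \<open>card S\<close> stays while the ground set shrinks by the length of
      the cycle, which shifts \<open>j\<close>.\<close>
    have "{S\<in>P. S \<inter> ?C = {}} =
        {S. S \<subseteq> I - ?C - {v} \<and> int (card S) = int (card (I - ?C)) - (j - int (length ws))}"
      using cardI by (auto simp: P_def)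
    then show ?thesis
      using disj by (auto simp: hook_char_def F'_def Q'_def intro!: sum.cong)
  qed
  also have "(\<Sum>S\<in>{S\<in>P. ?C \<subseteq> S}. F S) = (-1) ^ (length ws + 1) * hook_char (I - ?C) v j ?\<tau>'"
  proof -
    \<comment> \<open>Both \<open>card S\<close> and the ground set shrink by the length of the
      cycle, so \<open>j\<close> is unchanged.\<close>
    have "bij_betw (\<lambda>S. ?C \<union> S) {S. S \<subseteq> I - ?C - {v} \<and> int (card S) = int (card (I - ?C)) - j} {S\<in>P. ?C \<subseteq> S}"
    proof (rule bij_betw_byWitness[where f' = "\<lambda>S. S - ?C"])
      show "(\<union>) ?C ` {S. S \<subseteq> I - ?C - {v} \<and> int (card S) = int (card (I - ?C)) - j} \<subseteq> {S\<in>P. ?C \<subseteq> S}"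
      proof clarify
        fix S assume S: "S \<subseteq> I - ?C - {v}" "int (card S) = int (card (I - ?C)) - j"
        then have "card (?C \<union> S) = length ws + card S"
          using fin cardC by (subst card_Un_disjoint) (auto intro: finite_subset)
        then show "?C \<union> S \<in> P \<and> ?C \<subseteq> ?C \<union> S" using S v ws(3) cardI by (auto simp: P_def)
      qed
      show "(\<lambda>S. S - ?C) ` {S\<in>P. ?C \<subseteq> S} \<subseteq> {S. S \<subseteq> I - ?C - {v} \<and> int (card S) = int (card (I - ?C)) - j}"
      proof clarify
        fix S assume S: "S \<in> P" "?C \<subseteq> S"
        then have "finite S" using fin by (auto simp: P_def intro: finite_subset)
        then have "card S = card (S - ?C) + length ws"
          using card_Diff_subset[of ?C S] card_mono[of S ?C] S(2) cardC by auto
        then show "S - ?C \<subseteq> I - ?C - {v} \<and> int (card (S - ?C)) = int (card (I - ?C)) - j"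
          using S cardI by (auto simp: P_def)
      qed
    qed auto
    then have "(\<Sum>S\<in>{S\<in>P. ?C \<subseteq> S}. F S) =
      (\<Sum>S | S \<subseteq> I - ?C - {v} \<and> int (card S) = int (card (I - ?C)) - j. F (?C \<union> S))"
      by (rule sum.reindex_bij_betw[symmetric])
    also have "\<dots> = (\<Sum>S | S \<subseteq> I - ?C - {v} \<and> int (card S) = int (card (I - ?C)) - j.
        (-1) ^ (length ws + 1) * F' S)"
      using full by (intro sum.cong) auto
    finally show ?thesis by (simp add: hook_char_def F'_def Q'_def sum_distrib_left)
  qed
  finally show ?thesis .
qed

text \<open>If the cycle misses a point, that point is taken as apex. Otherwise the right-hand side
  consists of values on the empty set and is compared with the character of a full cycle.\<close>

lemma hook_weight_remove_cycle:
  assumes fin: "finite I" and ws: "distinct ws" "ws \<noteq> []" "set ws \<subseteq> I"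
    and \<sigma>: "\<sigma> permutes I - set ws"
  shows "hook_weight I j (cycle_of_list ws \<circ> \<sigma>) =
    hook_weight (I - set ws) (j - int (length ws)) \<sigma>
    + (-1) ^ (length ws + 1) * hook_weight (I - set ws) j \<sigma>"
proof (cases "I = set ws")
  case False
  then obtain v where v: "v \<in> I - set ws" using ws by blast
  have "cycle_of_list ws \<circ> \<sigma> permutes I"
    by (intro permutes_compose permutes_subset[OF \<sigma>] permutes_subset[OF cycle_permutes] ws) auto
  then show ?thesis
    using hook_char_remove_cycle[OF fin ws v \<sigma>] fin v \<sigma> by (simp add: hook_weight_eq_hook_char[of _ v])
next
  case True
  then have \<sigma>_id: "\<sigma> = id" using \<sigma> by simp
  have card: "card (set ws) = length ws" using ws by (simp add: distinct_card)
  \<comment> \<open>In range, the shifted term alone survives and is the character of the full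
    cycle. For \<open>j \<le> 0\<close> both terms are nonzero and cancel, and above the range both
    vanish.\<close>
  consider "1 \<le> j" "j \<le> int (length ws)" | "j \<le> 0" | "int (length ws) < j" by linarith
  then show ?thesis
  proof cases
    case 1
    have "hook_weight (set ws) j (cycle_of_list ws) = (-1) ^ nat (int (length ws) - j)"
      using hook_weight_eq_hook_char[of "set ws" "hd ws" "cycle_of_list ws" j] ws
        hook_char_full_cycle[OF ws(1,2) 1] by (simp add: cycle_permutes)
    then show ?thesis using 1 by (simp add: True \<sigma>_id hook_weight_def)
  next
    case 2
    have "nat (int (length ws) - j) = length ws + nat (- j)" using 2 by simp
    then show ?thesis using 2 ws by (simp add: True \<sigma>_id hook_weight_def power_add)
  next
    case 3
    then show ?thesis using ws card by (simp add: True \<sigma>_id hook_weight_def)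
  qed
qed

section \<open>Expansion of a hook immanant along a vertex\<close>

text \<open>Fixing the first entry makes a list the same thing as an oriented cycle through
  \<open>v\<close>; length 1 stands for a fixed point and length 2 for a transposition.\<close>

definition rooted_lists :: "'v set \<Rightarrow> 'v \<Rightarrow> 'v list set" where
  "rooted_lists V v = {ws. distinct ws \<and> set ws \<subseteq> V \<and> ws \<noteq> [] \<and> hd ws = v}"

text \<open>For length 1 the index wraps around at once, so the weight is the diagonal
  entry.\<close>

definition cycle_weight :: "('v \<Rightarrow> 'v \<Rightarrow> real) \<Rightarrow> 'v list \<Rightarrow> real" where
  "cycle_weight M ws = (\<Prod>i<length ws. M (ws ! i) (ws ! (Suc i mod length ws)))"

lemma finite_rooted_lists:
  assumes "finite V"
  shows "finite (rooted_lists V v)"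
proof (rule finite_subset)
  show "rooted_lists V v \<subseteq> {ws. set ws \<subseteq> V \<and> length ws \<le> card V}"
    using assms by (auto simp: rooted_lists_def) (metis card_mono distinct_card)
  show "finite {ws. set ws \<subseteq> V \<and> length ws \<le> card V}"
    by (rule finite_lists_length_le[OF assms])
qed

text \<open>Since \<open>\<sigma>\<close> fixes every entry of \<open>ws\<close>, the powers of the
  product walk from \<open>v\<close> along \<open>ws\<close> and first return after its full length.
  This recovers \<open>ws\<close> from the product.\<close>

lemma support_cycle_comp:
  assumes ws: "ws \<in> rooted_lists V v" and \<sigma>: "\<sigma> permutes V - set ws"
  shows "support (cycle_of_list ws \<circ> \<sigma>) v = ws"
proof -
  let ?p = "cycle_of_list ws \<circ> \<sigma>" and ?l = "length ws"
  have d: "distinct ws" "0 < ?l" "v = ws ! 0" using ws by (auto simp: rooted_lists_def hd_conv_nth)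
  have step: "?p (ws ! i) = ws ! (Suc i mod ?l)" if "i < ?l" for i
    using permutes_not_in[OF \<sigma>, of "ws ! i"] that cycle_of_list_nth[OF d(1) that] by simp
  have pow: "(?p ^^ n) v = ws ! (n mod ?l)" for n
  proof (induction n)
    case (Suc n)
    then show ?case using step[of "n mod ?l"] d(2) by (simp add: mod_Suc_eq)
  qed (use d in simp)
  have "least_power ?p v = ?l"
    unfolding least_power_def
  proof (rule Least_equality)
    show "(?p ^^ ?l) v = v \<and> 0 < ?l" using d pow[of ?l] by simp
    fix n assume n: "(?p ^^ n) v = v \<and> 0 < n"
    then have "ws ! (n mod ?l) = ws ! 0" using pow[of n] d(3) by metis
    moreover have "n mod ?l < ?l" using d(2) by simp
    ultimately have "n mod ?l = 0" using nth_eq_iff_index_eq[OF d(1) _ d(2)] by blast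
    then show "?l \<le> n" using n by (meson dvd_imp_le mod_eq_0_iff_dvd)
  qed
  then show ?thesis using pow by (intro nth_equalityI) simp_all
qed

lemma bij_betw_cycle_comp:
  assumes fin: "finite V" and v: "v \<in> V"
  shows "bij_betw (\<lambda>(ws, \<sigma>). cycle_of_list ws \<circ> \<sigma>)
    (SIGMA ws:rooted_lists V v. {\<sigma>. \<sigma> permutes V - set ws}) {\<sigma>. \<sigma> permutes V}"
proof -
  \<comment> \<open>The inverse map reads off the orbit of \<open>v\<close> as a list and resets
    \<open>p\<close> to the identity on that orbit.\<close>
  let ?rest = "\<lambda>p y. if y \<in> V - set (support p v) then p y else y"
  show ?thesis
  proof (rule bij_betw_byWitness[where f' = "\<lambda>p. (support p v, ?rest p)"])
    show "\<forall>x\<in>SIGMA ws:rooted_lists V v. {\<sigma>. \<sigma> permutes V - set ws}.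
        (support ((\<lambda>(ws, \<sigma>). cycle_of_list ws \<circ> \<sigma>) x) v, ?rest ((\<lambda>(ws, \<sigma>). cycle_of_list ws \<circ> \<sigma>) x)) = x"
    proof (rule ballI)
      fix x assume "x \<in> (SIGMA ws:rooted_lists V v. {\<sigma>. \<sigma> permutes V - set ws})"
      then obtain ws \<sigma> where x: "x = (ws, \<sigma>)"
        and ws: "ws \<in> rooted_lists V v" and \<sigma>: "\<sigma> permutes V - set ws" by blast
      have "(if y \<in> V - set ws then (cycle_of_list ws \<circ> \<sigma>) y else y) = \<sigma> y" for y
        using permutes_in_image[OF \<sigma>, of y] permutes_not_in[OF \<sigma>, of y] id_outside_supp[of "\<sigma> y" ws] by auto
      then show "(support ((\<lambda>(ws, \<sigma>). cycle_of_list ws \<circ> \<sigma>) x) v,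
          ?rest ((\<lambda>(ws, \<sigma>). cycle_of_list ws \<circ> \<sigma>) x)) = x"
        unfolding x split_conv support_cycle_comp[OF ws \<sigma>] by (simp add: fun_eq_iff)
    qed
    show "\<forall>p\<in>{\<sigma>. \<sigma> permutes V}. (\<lambda>(ws, \<sigma>). cycle_of_list ws \<circ> \<sigma>) (support p v, ?rest p) = p"
    proof (rule ballI)
      fix p assume "p \<in> {\<sigma>. \<sigma> permutes V}"
      then have p: "p permutes V" by simp
      have perm: "permutation p" using p fin by (auto intro: permutes_imp_permutation)
      have "cycle_of_list (support p v) (?rest p y) = p y" for y
      proof (cases "y \<in> set (support p v)")
        case True
        then show ?thesis using cycle_restrict[OF perm True] by simp
      next
        case False
        show ?thesis
        proof (cases "y \<in> V")
          case True
          then have "?rest p y \<in> V - set (support p v)"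
            using permutes_in_image[OF semidecomposition[OF p fin, of v], of y] False by blast
          then show ?thesis using True False id_outside_supp[of "p y" "support p v"] by auto
        next
          case out: False
          then show ?thesis
            using False id_outside_supp[of y "support p v"] permutes_not_in[OF p out] by auto
        qed
      qed
      then show "(\<lambda>(ws, \<sigma>). cycle_of_list ws \<circ> \<sigma>) (support p v, ?rest p) = p"
        by (simp add: fun_eq_iff)
    qed
    show "(\<lambda>(ws, \<sigma>). cycle_of_list ws \<circ> \<sigma>) ` (SIGMA ws:rooted_lists V v. {\<sigma>. \<sigma> permutes V - set ws})
        \<subseteq> {\<sigma>. \<sigma> permutes V}"
    proof (rule image_subsetI)
      fix x assume "x \<in> (SIGMA ws:rooted_lists V v. {\<sigma>. \<sigma> permutes V - set ws})"
      then obtain ws \<sigma> where x: "x = (ws, \<sigma>)"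
        and ws: "ws \<in> rooted_lists V v" and \<sigma>: "\<sigma> permutes V - set ws" by blast
      have "set ws \<subseteq> V" using ws by (simp add: rooted_lists_def)
      then have "cycle_of_list ws \<circ> \<sigma> permutes V"
        by (intro permutes_compose permutes_subset[OF \<sigma>] permutes_subset[OF cycle_permutes]) auto
      then show "(\<lambda>(ws, \<sigma>). cycle_of_list ws \<circ> \<sigma>) x \<in> {\<sigma>. \<sigma> permutes V}"
        unfolding x by simp
    qed
    show "(\<lambda>p. (support p v, ?rest p)) ` {\<sigma>. \<sigma> permutes V}
        \<subseteq> (SIGMA ws:rooted_lists V v. {\<sigma>. \<sigma> permutes V - set ws})"
    proof (rule image_subsetI)
      fix p assume "p \<in> {\<sigma>. \<sigma> permutes V}"
      then have p: "p permutes V" by simp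
      have perm: "permutation p" using p fin by (auto intro: permutes_imp_permutation)
      have "support p v \<noteq> []" "hd (support p v) = v"
        using least_power_of_permutation(2)[OF perm, of v] by (auto simp: hd_map)
      moreover have "set (support p v) \<subseteq> V"
        using permutes_in_image[OF permutes_funpow[OF p]] v by auto
      ultimately have "support p v \<in> rooted_lists V v"
        using cycle_of_permutation[OF perm, of v] unfolding rooted_lists_def by blast
      then show "(support p v, ?rest p) \<in> (SIGMA ws:rooted_lists V v. {\<sigma>. \<sigma> permutes V - set ws})"
        using semidecomposition[OF p fin, of v] by blast
    qed
  qed
qed

lemma prod_cycle_comp:
  assumes fin: "finite V" and ws: "distinct ws" "set ws \<subseteq> V" and \<sigma>: "\<sigma> permutes V - set ws"
  shows "(\<Prod>i\<in>V. M i ((cycle_of_list ws \<circ> \<sigma>) i)) = cycle_weight M ws * (\<Prod>i\<in>V - set ws. M i (\<sigma> i))"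
proof -
  let ?p = "cycle_of_list ws \<circ> \<sigma>"
  have "(\<Prod>i\<in>V. M i (?p i)) = (\<Prod>i\<in>V - set ws. M i (?p i)) * (\<Prod>i\<in>set ws. M i (?p i))"
    by (rule prod.subset_diff[OF ws(2) fin])
  also have "(\<Prod>i\<in>V - set ws. M i (?p i)) = (\<Prod>i\<in>V - set ws. M i (\<sigma> i))"
  proof (rule prod.cong[OF refl])
    fix i assume "i \<in> V - set ws"
    then have "\<sigma> i \<notin> set ws" using permutes_in_image[OF \<sigma>] by blast
    then show "M i (?p i) = M i (\<sigma> i)" by (simp add: id_outside_supp)
  qed
  also have "(\<Prod>i\<in>set ws. M i (?p i)) = (\<Prod>i<length ws. M (ws ! i) (?p (ws ! i)))"
    using prod.reindex_bij_betw[OF bij_betw_nth[OF ws(1) refl refl], of "\<lambda>i. M i (?p i)"] by simp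
  also have "\<dots> = cycle_weight M ws"
    unfolding cycle_weight_def
  proof (rule prod.cong[OF refl])
    fix i assume "i \<in> {..<length ws}"
    then show "M (ws ! i) (?p (ws ! i)) = M (ws ! i) (ws ! (Suc i mod length ws))"
      using permutes_not_in[OF \<sigma>, of "ws ! i"] cycle_of_list_nth[OF ws(1), of i] by simp
  qed
  finally show ?thesis by (simp add: mult.commute)
qed

text \<open>For a fixed root cycle, weight and product both factor, and summing over the remaining
  permutation rebuilds immanants of the complement. Lists exhausting \<open>V\<close> lead to the
  empty matrix, where its convention enters.\<close>

lemma hook_immanant_expand:
  assumes fin: "finite V" and v: "v \<in> V"
  shows "hook_immanant V k M = (\<Sum>ws\<in>rooted_lists V v. cycle_weight M ws *
    (hook_immanant (V - set ws) (k - int (length ws)) M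
     + (-1) ^ (length ws + 1) * hook_immanant (V - set ws) k M))"
proof -
  let ?f = "\<lambda>\<sigma>. hook_weight V k \<sigma> * (\<Prod>i\<in>V. M i (\<sigma> i))"
  have "hook_immanant V k M = (\<Sum>\<sigma> | \<sigma> permutes V. ?f \<sigma>)"
    by (rule hook_immanant_eq_sum)
  also have "\<dots> = (\<Sum>(ws, \<sigma>)\<in>(SIGMA ws:rooted_lists V v. {\<sigma>. \<sigma> permutes V - set ws}). ?f (cycle_of_list ws \<circ> \<sigma>))"
    using sum.reindex_bij_betw[OF bij_betw_cycle_comp[OF fin v], of ?f] by (simp add: case_prod_unfold)
  also have "\<dots> = (\<Sum>ws\<in>rooted_lists V v. \<Sum>\<sigma> | \<sigma> permutes V - set ws. ?f (cycle_of_list ws \<circ> \<sigma>))"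
    using fin by (subst sum.Sigma) (auto simp: finite_rooted_lists finite_permutations)
  also have "\<dots> = (\<Sum>ws\<in>rooted_lists V v. cycle_weight M ws *
    (hook_immanant (V - set ws) (k - int (length ws)) M
     + (-1) ^ (length ws + 1) * hook_immanant (V - set ws) k M))"
  proof (rule sum.cong[OF refl])
    fix ws assume "ws \<in> rooted_lists V v"
    then have ws: "distinct ws" "ws \<noteq> []" "set ws \<subseteq> V" by (auto simp: rooted_lists_def)
    let ?P = "\<lambda>\<sigma>. \<Prod>i\<in>V - set ws. M i (\<sigma> i)"
    have "(\<Sum>\<sigma> | \<sigma> permutes V - set ws. ?f (cycle_of_list ws \<circ> \<sigma>)) =
      (\<Sum>\<sigma> | \<sigma> permutes V - set ws. cycle_weight M ws *
         (hook_weight (V - set ws) (k - int (length ws)) \<sigma> * ?P \<sigma>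
          + (-1) ^ (length ws + 1) * (hook_weight (V - set ws) k \<sigma> * ?P \<sigma>)))"
      by (intro sum.cong refl)
        (simp only: mem_Collect_eq hook_weight_remove_cycle[OF fin ws] prod_cycle_comp[OF fin ws(1,3)] algebra_simps)
    then show "(\<Sum>\<sigma> | \<sigma> permutes V - set ws. ?f (cycle_of_list ws \<circ> \<sigma>)) = cycle_weight M ws *
      (hook_immanant (V - set ws) (k - int (length ws)) M
       + (-1) ^ (length ws + 1) * hook_immanant (V - set ws) k M)"
      by (simp only: hook_immanant_eq_sum sum.distrib sum_distrib_left[symmetric])
  qed
  finally show ?thesis .
qed

section \<open>Cycles of a graph as rooted lists\<close>

text \<open>The edges depend on the list only through its cyclic permutation, which makes invariance
  under rotation immediate.\<close>

lemma cycle_edges_eq_image: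
  assumes "distinct ws"
  shows "cycle_edges ws = (\<lambda>x. {x, cycle_of_list ws x}) ` set ws"
proof -
  have "cycle_edges ws = (\<lambda>i. {ws ! i, cycle_of_list ws (ws ! i)}) ` {..<length ws}"
    unfolding cycle_edges_def using cycle_of_list_nth[OF assms] by auto
  also have "\<dots> = (\<lambda>x. {x, cycle_of_list ws x}) ` ((!) ws ` {..<length ws})"
    by (simp add: image_image)
  also have "(!) ws ` {..<length ws} = set ws"
    using bij_betw_nth[OF assms refl refl] by (simp add: bij_betw_def)
  finally show ?thesis .
qed

lemma cycle_edges_rotate:
  assumes "distinct ws"
  shows "cycle_edges (rotate n ws) = cycle_edges ws"
  using assms cycle_of_list_rotate_independent[OF assms, of n] by (simp add: cycle_edges_eq_image)

text \<open>The reversed list gives the inverse cyclic permutation, and an edge from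
  \<open>x\<close> to its successor is also the edge from the successor back to
  \<open>x\<close>.\<close>

lemma cycle_edges_rev:
  assumes "distinct ws"
  shows "cycle_edges (rev ws) = cycle_edges ws"
proof -
  have inverts: "cycle_of_list (rev ws) (cycle_of_list ws (ws ! i)) = ws ! i" if i: "i < length ws" for i
  proof (cases "Suc i = length ws")
    case True
    then have "ws ! (Suc i mod length ws) = rev ws ! i"
      using i by (simp add: rev_nth)
    moreover have "cycle_of_list (rev ws) (rev ws ! i) = rev ws ! 0"
      using cycle_of_list_nth[of "rev ws" i] assms i True by simp
    moreover have "rev ws ! 0 = ws ! i" using True i by (simp add: rev_nth flip: True)
    ultimately show ?thesis using cycle_of_list_nth[OF assms i] by simp
  next
    case False
    then have "ws ! (Suc i mod length ws) = rev ws ! (length ws - 2 - i)"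
      using i by (simp add: rev_nth Suc_diff_Suc numeral_2_eq_2)
    moreover have "cycle_of_list (rev ws) (rev ws ! (length ws - 2 - i)) = rev ws ! (length ws - 1 - i)"
      using cycle_of_list_nth[of "rev ws" "length ws - 2 - i"] assms i False
      by (simp add: Suc_diff_Suc numeral_2_eq_2)
    moreover have "rev ws ! (length ws - 1 - i) = ws ! i" using i by (simp add: rev_nth)
    ultimately show ?thesis using cycle_of_list_nth[OF assms i] by simp
  qed
  let ?c = "cycle_of_list ws" and ?d = "cycle_of_list (rev ws)"
  have inverts': "?d (?c x) = x" if "x \<in> set ws" for x
    using that inverts by (auto simp: in_set_conv_nth)
  have "cycle_edges (rev ws) = (\<lambda>x. {x, ?d x}) ` (?c ` set ws)"
    using assms permutes_image[OF cycle_permutes[of ws]] by (simp add: cycle_edges_eq_image)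
  also have "\<dots> = (\<lambda>x. {x, ?c x}) ` set ws"
    unfolding image_image using inverts' by (intro image_cong refl) auto
  finally show ?thesis using assms by (simp add: cycle_edges_eq_image)
qed

text \<open>Plain reversal would move the root to the end; this version is its rotation that keeps
  the root in front.\<close>

definition reverse_cycle :: "'v list \<Rightarrow> 'v list" where
  "reverse_cycle ws = hd ws # rev (tl ws)"

lemma reverse_cycle_properties:
  assumes "distinct ws" "3 \<le> length ws"
  shows "distinct (reverse_cycle ws)" "length (reverse_cycle ws) = length ws"
    "set (reverse_cycle ws) = set ws" "hd (reverse_cycle ws) = hd ws"
    "cycle_edges (reverse_cycle ws) = cycle_edges ws" "reverse_cycle ws \<noteq> ws"
    "reverse_cycle ws ! 1 = last ws"
proof -
  obtain v a b us where ws: "ws = v # a # us @ [b]"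
  proof -
    obtain v a us' where "ws = v # a # us'" "us' \<noteq> []"
      using assms(2) by (cases ws; cases "tl ws"; cases "tl (tl ws)") auto
    then show ?thesis using that[of v a "butlast us'" "last us'"] by simp
  qed
  show dist: "distinct (reverse_cycle ws)" using assms by (auto simp: reverse_cycle_def ws)
  show "length (reverse_cycle ws) = length ws" "set (reverse_cycle ws) = set ws"
    "hd (reverse_cycle ws) = hd ws" "reverse_cycle ws ! 1 = last ws"
    by (auto simp: reverse_cycle_def ws)
  show "reverse_cycle ws \<noteq> ws" using assms by (auto simp: reverse_cycle_def ws)
  have "rotate 1 (reverse_cycle ws) = rev ws" by (simp add: reverse_cycle_def ws)
  then show "cycle_edges (reverse_cycle ws) = cycle_edges ws"
    using cycle_edges_rotate[OF dist, of 1] cycle_edges_rev[OF assms(1)] by metis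
qed

text \<open>The second alternative is the predecessor of index \<open>i\<close>, phrased through its
  successor so that \<open>i = 0\<close> needs no separate formula.\<close>

lemma cycle_edges_neighbour:
  assumes "distinct ws" "i < length ws" "{ws ! i, y} \<in> cycle_edges ws"
  shows "y = ws ! (Suc i mod length ws) \<or> (\<exists>k<length ws. y = ws ! k \<and> Suc k mod length ws = i)"
proof -
  obtain k where k: "k < length ws" "{ws ! i, y} = {ws ! k, ws ! (Suc k mod length ws)}"
    using assms(3) by (auto simp: cycle_edges_def)
  then have "ws ! i = ws ! k \<and> y = ws ! (Suc k mod length ws) \<or> ws ! i = ws ! (Suc k mod length ws) \<and> y = ws ! k"
    by (simp add: doubleton_eq_iff)
  moreover have "Suc k mod length ws < length ws" using k by (intro mod_less_divisor) auto
  ultimately show ?thesis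
    using k(1) assms(2) nth_eq_iff_index_eq[OF assms(1)] by metis
qed

text \<open>Walking along the cycle, the next vertex is a neighbour of the current one other than
  the vertex just left. The first two entries therefore determine all others.\<close>

lemma cycle_edges_inj:
  assumes ws: "distinct ws" and us: "distinct us" and len: "length us = length ws"
    and edges: "cycle_edges us \<subseteq> cycle_edges ws" and 0: "us ! 0 = ws ! 0" and 1: "us ! 1 = ws ! 1"
  shows "us = ws"
proof -
  have "Suc i < length ws \<Longrightarrow> us ! i = ws ! i \<and> us ! Suc i = ws ! Suc i" for i
  proof (induction i)
    case 0
    then show ?case using assms by simp
  next
    case (Suc i)
    then have IH: "us ! i = ws ! i" "us ! Suc i = ws ! Suc i" by auto
    have "{us ! Suc i, us ! Suc (Suc i)} \<in> cycle_edges us"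
      using Suc.prems len unfolding cycle_edges_def by (intro CollectI exI[of _ "Suc i"]) auto
    then have "{ws ! Suc i, us ! Suc (Suc i)} \<in> cycle_edges ws" using edges IH by auto
    from cycle_edges_neighbour[OF ws _ this] Suc.prems consider
      "us ! Suc (Suc i) = ws ! Suc (Suc i)" | k where "k < length ws" "us ! Suc (Suc i) = ws ! k" "Suc k mod length ws = Suc i"
      by auto
    then show ?case
    proof cases
      case 2
      \<comment> \<open>The other neighbour is the vertex just left, and distinctness of
        \<open>us\<close> excludes it.\<close>
      then have "k = i" by (cases "Suc k = length ws") auto
      then have "us ! Suc (Suc i) = us ! i" using 2 IH by simp
      then show ?thesis using Suc.prems len nth_eq_iff_index_eq[OF us, of "Suc (Suc i)" i] by auto
    qed (use IH in simp)
  qed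
  note * = this
  show ?thesis
  proof (rule nth_equalityI[OF len])
    fix i assume "i < length us"
    then show "us ! i = ws ! i"
      using *[of "i - 1"] 0 len by (cases i) auto
  qed
qed

text \<open>The root has two neighbours on the cycle, the second entry and the last; which one comes
  next fixes the orientation.\<close>

lemma cycle_edges_eq_cases:
  assumes ws: "distinct ws" and us: "distinct us" and 3: "3 \<le> length ws" "length us = length ws"
    and hd: "hd us = hd ws" and edges: "cycle_edges us = cycle_edges ws"
  shows "us = ws \<or> us = reverse_cycle ws"
proof -
  have nonempty: "ws \<noteq> []" "us \<noteq> []" using 3 by auto
  have 0: "us ! 0 = ws ! 0" using hd nonempty by (simp add: hd_conv_nth)
  have "{us ! 0, us ! 1} \<in> cycle_edges us"
    using 3 unfolding cycle_edges_def by (intro CollectI exI[of _ 0]) auto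
  then have "{ws ! 0, us ! 1} \<in> cycle_edges ws" using 0 edges by simp
  from cycle_edges_neighbour[OF ws _ this] 3 consider
    "us ! 1 = ws ! 1" | k where "k < length ws" "us ! 1 = ws ! k" "Suc k mod length ws = 0"
    by fastforce
  then show ?thesis
  proof cases
    case 1
    then show ?thesis using cycle_edges_inj[OF ws us 3(2)] edges 0 by blast
  next
    case 2
    then have "k = length ws - 1" by (cases "Suc k = length ws") auto
    then have "us ! 1 = last ws" using 2 nonempty by (simp add: last_conv_nth)
    then show ?thesis
      using cycle_edges_inj[of "reverse_cycle ws" us] reverse_cycle_properties[OF ws 3(1)] us 3 0 edges hd nonempty
      by (metis hd_conv_nth length_0_conv order_refl)
  qed
qed

text \<open>The origin of the factor 2: passing from rooted lists to subgraphs is onto, by rotating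
  a cycle to its root, and each fibre consists of a list and its reversal.\<close>

lemma sum_rooted_cycles:
  fixes h :: "'v set \<times> 'v set set \<Rightarrow> real"
  assumes G: "simple_graph V E"
  shows "(\<Sum>ws | ws \<in> rooted_lists V v \<and> 3 \<le> length ws \<and> cycle_edges ws \<subseteq> E. h (set ws, cycle_edges ws))
    = 2 * (\<Sum>C\<in>cycles_through_vertex E v. h C)"
proof -
  let ?R = "{ws. ws \<in> rooted_lists V v \<and> 3 \<le> length ws \<and> cycle_edges ws \<subseteq> E}"
  let ?f = "\<lambda>ws. (set ws, cycle_edges ws)"
  have finR: "finite ?R"
    using finite_rooted_lists[of V v] G by (auto simp: simple_graph_def)
  have img: "?f ` ?R = cycles_through_vertex E v"
  proof
    show "?f ` ?R \<subseteq> cycles_through_vertex E v"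
      by (auto simp: cycles_through_vertex_def cycles_def rooted_lists_def)
    show "cycles_through_vertex E v \<subseteq> ?f ` ?R"
    proof
      fix C assume "C \<in> cycles_through_vertex E v"
      then obtain us where us: "C = ?f us" "distinct us" "3 \<le> length us" "cycle_edges us \<subseteq> E" "v \<in> set us"
        by (auto simp: cycles_through_vertex_def cycles_def)
      then obtain i where i: "i < length us" "v = us ! i" by (auto simp: in_set_conv_nth)
      let ?ws = "rotate i us"
      have "set us \<subseteq> V"
      proof
        fix x assume "x \<in> set us"
        then have "{x, cycle_of_list us x} \<in> E" using us(4) by (auto simp: cycle_edges_eq_image[OF us(2)])
        then show "x \<in> V" using G by (auto simp: simple_graph_def)
      qed
      moreover have "hd ?ws = v" using i us(3) by (subst hd_rotate_conv_nth) auto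
      ultimately have "?ws \<in> ?R"
        using us cycle_edges_rotate[OF us(2), of i] by (auto simp: rooted_lists_def)
      moreover have "C = ?f ?ws" using us cycle_edges_rotate[OF us(2), of i] by simp
      ultimately show "C \<in> ?f ` ?R" by blast
    qed
  qed
  have fibre: "card {ws \<in> ?R. ?f ws = ?f us} = 2" if us: "us \<in> ?R" for us
  proof -
    have d: "distinct us" "3 \<le> length us" "hd us = v" using us by (auto simp: rooted_lists_def)
    note rev = reverse_cycle_properties[OF d(1,2)]
    have "{ws \<in> ?R. ?f ws = ?f us} = {us, reverse_cycle us}"
    proof (intro equalityI subsetI)
      fix ws assume "ws \<in> {ws \<in> ?R. ?f ws = ?f us}"
      then have ws: "distinct ws" "hd ws = v" "set ws = set us" "cycle_edges ws = cycle_edges us"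
        by (auto simp: rooted_lists_def)
      have "length ws = length us" using ws d by (metis distinct_card)
      then show "ws \<in> {us, reverse_cycle us}"
        using cycle_edges_eq_cases[OF d(1) ws(1) d(2)] ws d by auto
    next
      fix ws assume "ws \<in> {us, reverse_cycle us}"
      then show "ws \<in> {ws \<in> ?R. ?f ws = ?f us}"
        using us rev d by (auto simp: rooted_lists_def)
    qed
    then show ?thesis using rev(6) by simp
  qed
  have "(\<Sum>ws\<in>?R. h (?f ws)) = (\<Sum>C\<in>?f ` ?R. \<Sum>ws\<in>{ws \<in> ?R. ?f ws = C}. h (?f ws))"
    by (rule sum.image_gen[OF finR])
  also have "\<dots> = (\<Sum>C\<in>?f ` ?R. 2 * h C)"
  proof (rule sum.cong[OF refl])
    fix C assume "C \<in> ?f ` ?R"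
    then have card: "card {ws \<in> ?R. ?f ws = C} = 2" using fibre by force
    have "(\<Sum>ws\<in>{ws \<in> ?R. ?f ws = C}. h (?f ws)) = (\<Sum>ws\<in>{ws \<in> ?R. ?f ws = C}. h C)"
      by (rule sum.cong) auto
    then show "(\<Sum>ws\<in>{ws \<in> ?R. ?f ws = C}. h (?f ws)) = 2 * h C" using card by simp
  qed
  finally show ?thesis by (simp only: img sum_distrib_left)
qed

text \<open>From length 2 on, cyclically consecutive entries differ, so no diagonal entry occurs in
  the product.\<close>

lemma cycle_weight_offdiagonal:
  assumes ws: "distinct ws" "2 \<le> length ws"
    and M: "\<And>a b. a \<noteq> b \<Longrightarrow> M a b = (if {a, b} \<in> E then c else 0)"
  shows "cycle_weight M ws = (if cycle_edges ws \<subseteq> E then c ^ length ws else 0)"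
proof -
  let ?e = "\<lambda>i. {ws ! i, ws ! (Suc i mod length ws)}"
  have "cycle_weight M ws = (\<Prod>i<length ws. if ?e i \<in> E then c else 0)"
    unfolding cycle_weight_def
  proof (rule prod.cong[OF refl])
    fix i assume "i \<in> {..<length ws}"
    then have i: "i < length ws" by simp
    have "Suc i mod length ws \<noteq> i" using i ws(2) by (cases "Suc i = length ws") auto
    moreover have "Suc i mod length ws < length ws" using i by (intro mod_less_divisor) auto
    ultimately have "ws ! i \<noteq> ws ! (Suc i mod length ws)"
      using nth_eq_iff_index_eq[OF ws(1) i] by metis
    then show "M (ws ! i) (ws ! (Suc i mod length ws)) = (if ?e i \<in> E then c else 0)"
      by (rule M)
  qed
  also have "\<dots> = (if cycle_edges ws \<subseteq> E then c ^ length ws else 0)"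
  proof (cases "cycle_edges ws \<subseteq> E")
    case True
    then have "\<forall>i<length ws. ?e i \<in> E" by (auto simp: cycle_edges_def)
    then show ?thesis using True by simp
  next
    case False
    then obtain i where "i < length ws" "?e i \<notin> E" by (auto simp: cycle_edges_def)
    then show ?thesis using False by (auto intro!: prod_zero)
  qed
  finally show ?thesis .
qed

lemma sum_rooted_lists_split:
  fixes f :: "'v list \<Rightarrow> real"
  assumes fin: "finite V" and v: "v \<in> V"
  shows "(\<Sum>ws\<in>rooted_lists V v. f ws) =
    f [v] + (\<Sum>u\<in>V - {v}. f [v, u]) + (\<Sum>ws | ws \<in> rooted_lists V v \<and> 3 \<le> length ws. f ws)"
proof -
  let ?L = "{ws. ws \<in> rooted_lists V v \<and> 3 \<le> length ws}" and ?P = "(\<lambda>u. [v, u]) ` (V - {v})"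
  have split: "rooted_lists V v = insert [v] (?P \<union> ?L)"
  proof (intro equalityI subsetI)
    fix ws assume ws: "ws \<in> rooted_lists V v"
    then obtain us where us: "ws = v # us" by (cases ws) (auto simp: rooted_lists_def)
    then consider "us = []" | u where "us = [u]" | "3 \<le> length ws"
      by (cases us; cases "tl us") auto
    then show "ws \<in> insert [v] (?P \<union> ?L)"
      using ws us by cases (auto simp: rooted_lists_def)
  qed (use v in \<open>auto simp: rooted_lists_def\<close>)
  have finL: "finite ?L" using finite_rooted_lists[OF fin, of v] by simp
  have "sum f (rooted_lists V v) = sum f (insert [v] (?P \<union> ?L))"
    using split by (rule arg_cong)
  also have "\<dots> = f [v] + sum f (?P \<union> ?L)"
    using fin finL by (intro sum.insert) auto
  also have "sum f (?P \<union> ?L) = sum f ?P + sum f ?L"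
    using fin finL by (intro sum.union_disjoint) auto
  also have "sum f ?P = (\<Sum>u\<in>V - {v}. f [v, u])"
    by (subst sum.reindex) (auto simp: inj_on_def)
  finally show ?thesis by simp
qed

section \<open>Vertex and edge expansions\<close>

lemma hook_immanant_cong:
  assumes "\<And>a b. a \<in> I \<Longrightarrow> b \<in> I \<Longrightarrow> M a b = N a b"
  shows "hook_immanant I j M = hook_immanant I j N"
  unfolding hook_immanant_eq_sum
proof (rule sum.cong[OF refl])
  fix \<sigma> assume "\<sigma> \<in> {\<sigma>. \<sigma> permutes I}"
  then have "M i (\<sigma> i) = N i (\<sigma> i)" if "i \<in> I" for i
    using that assms permutes_in_image[of \<sigma> I] by simp
  then show "hook_weight I j \<sigma> * (\<Prod>i\<in>I. M i (\<sigma> i)) = hook_weight I j \<sigma> * (\<Prod>i\<in>I. N i (\<sigma> i))"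
    by simp
qed

text \<open>In the expansion along \<open>v\<close>, the entry at \<open>(v, v)\<close> occurs only
  in the weight of \<open>[v]\<close>: longer cycles never pair \<open>v\<close> with itself, and
  the smaller matrices have lost its row and column.\<close>

lemma hook_immanant_diagonal_change:
  assumes fin: "finite V" and v: "v \<in> V"
    and N: "N v v = M v v - b" and eq: "\<And>a c. (a, c) \<noteq> (v, v) \<Longrightarrow> N a c = M a c"
  shows "hook_immanant V k N = hook_immanant V k M
    - b * (hook_immanant (V - {v}) k M + hook_immanant (V - {v}) (k - 1) M)"
proof -
  let ?g = "\<lambda>M ws. hook_immanant (V - set ws) (k - int (length ws)) M
     + (-1) ^ (length ws + 1) * hook_immanant (V - set ws) k M"
  have g: "?g N ws = ?g M ws" if "v \<in> set ws" for ws
  proof -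
    have "hook_immanant (V - set ws) j N = hook_immanant (V - set ws) j M" for j
      using that by (intro hook_immanant_cong eq) auto
    then show ?thesis by simp
  qed
  have same: "cycle_weight N ws * ?g N ws = cycle_weight M ws * ?g M ws"
    if ws: "ws \<in> rooted_lists V v - {[v]}" for ws
  proof -
    obtain us where us: "ws = v # us" using ws by (cases ws) (auto simp: rooted_lists_def)
    have d: "distinct ws" "us \<noteq> []" using ws us by (auto simp: rooted_lists_def)
    have "cycle_weight N ws = cycle_weight M ws"
      unfolding cycle_weight_def
    proof (rule prod.cong[OF refl])
      fix i assume "i \<in> {..<length ws}"
      then have i: "i < length ws" by simp
      have "2 \<le> length ws" using d(2) us by (cases us) auto
      then have "Suc i mod length ws \<noteq> i" using i by (cases "Suc i = length ws") auto
      moreover have "Suc i mod length ws < length ws" using i by (intro mod_less_divisor) auto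
      ultimately have "ws ! i \<noteq> ws ! (Suc i mod length ws)"
        using nth_eq_iff_index_eq[OF d(1) i] by metis
      then show "N (ws ! i) (ws ! (Suc i mod length ws)) = M (ws ! i) (ws ! (Suc i mod length ws))"
        by (intro eq) auto
    qed
    then show ?thesis using g[of ws] us by simp
  qed
  have root: "[v] \<in> rooted_lists V v" using v by (simp add: rooted_lists_def)
  note finR = finite_rooted_lists[OF fin, of v]
  have N_exp: "hook_immanant V k N = cycle_weight N [v] * ?g N [v]
      + (\<Sum>ws\<in>rooted_lists V v - {[v]}. cycle_weight M ws * ?g M ws)"
    unfolding hook_immanant_expand[OF fin v, of k N] using same
    by (subst sum.remove[OF finR root]) simp
  have M_exp: "hook_immanant V k M = cycle_weight M [v] * ?g M [v]
      + (\<Sum>ws\<in>rooted_lists V v - {[v]}. cycle_weight M ws * ?g M ws)"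
    unfolding hook_immanant_expand[OF fin v, of k M]
    by (subst sum.remove[OF finR root]) simp
  have root_g: "?g N [v] = ?g M [v]" by (rule g) simp
  have root_w: "cycle_weight N [v] = M v v - b" "cycle_weight M [v] = M v v"
    by (simp_all add: cycle_weight_def N)
  show ?thesis unfolding N_exp M_exp root_g root_w by (simp add: algebra_simps)
qed

text \<open>Merges the sign of the entries \<open>- \<gamma>\<close> along a cycle with the sign of
  the removal rule.\<close>

lemma cycle_term_sign:
  fixes c A B :: real
  shows "(- c) ^ l * (A + (-1) ^ (l + 1) * B) = c ^ l * ((-1) ^ l * A - B)"
  by (cases "even l") (simp_all add: algebra_simps)

lemma H_matrix_offdiagonal:
  "a \<noteq> b \<Longrightarrow> (if a = b then x else 0) - H_matrix \<beta> \<gamma> E a b = (if {a, b} \<in> E then - \<gamma> else 0)"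
  by (simp add: H_matrix_def degree_matrix_def adjacency_matrix_def)

lemma vertex_expansion:
  assumes G: "simple_graph V E" and v: "v \<in> V"
  shows "hook_immanantal_poly V k (H_matrix \<beta> \<gamma> E) x =
        (x - \<beta> * real (degree E v)) *
          (hook_immanantal_poly (V - {v}) (k - 1) (H_matrix \<beta> \<gamma> E) x
           + hook_immanantal_poly (V - {v}) k (H_matrix \<beta> \<gamma> E) x)
        + \<gamma>\<^sup>2 * (\<Sum>u\<in>neighbours E v.
            hook_immanantal_poly (V - {u, v}) (k - 2) (H_matrix \<beta> \<gamma> E) x
            - hook_immanantal_poly (V - {u, v}) k (H_matrix \<beta> \<gamma> E) x)
        + 2 * (\<Sum>(W, F)\<in>cycles_through_vertex E v.
            \<gamma> ^ card W *
              ((-1) ^ card W * hook_immanantal_poly (V - W) (k - int (card W)) (H_matrix \<beta> \<gamma> E) x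
               - hook_immanantal_poly (V - W) k (H_matrix \<beta> \<gamma> E) x))"
proof -
  define M where "M = (\<lambda>u v. (if u = v then x else 0) - H_matrix \<beta> \<gamma> E u v)"
  have poly: "hook_immanantal_poly I j (H_matrix \<beta> \<gamma> E) x = hook_immanant I j M" for I j
    by (simp add: hook_immanantal_poly_def M_def)
  have fin: "finite V" and edge: "\<And>e. e \<in> E \<Longrightarrow> e \<subseteq> V \<and> card e = 2" using G by (auto simp: simple_graph_def)
  have off: "M a b = (if {a, b} \<in> E then - \<gamma> else 0)" if "a \<noteq> b" for a b
    unfolding M_def using that by (rule H_matrix_offdiagonal)
  \<comment> \<open>The adjacency entry at \<open>(v, v)\<close> asks whether \<open>{v}\<close> is
    an edge; edges have two elements.\<close>
  have Mvv: "M v v = x - \<beta> * real (degree E v)"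
    using edge[of "{v}"] by (auto simp: M_def H_matrix_def degree_matrix_def adjacency_matrix_def)
  let ?g = "\<lambda>ws. hook_immanant (V - set ws) (k - int (length ws)) M
     + (-1) ^ (length ws + 1) * hook_immanant (V - set ws) k M"
  have nb: "neighbours E v \<subseteq> V - {v}"
    using edge by (fastforce simp: neighbours_def)
  \<comment> \<open>Transpositions use an edge in both directions: the two signs of
    \<open>- \<gamma>\<close> cancel, and the removal rule for length 2 puts a minus sign on the
    unshifted term.\<close>
  have "(\<Sum>u\<in>V - {v}. cycle_weight M [v, u] * ?g [v, u]) =
      (\<Sum>u\<in>neighbours E v. \<gamma>\<^sup>2 * (hook_immanant (V - {u, v}) (k - 2) M - hook_immanant (V - {u, v}) k M))"
  proof (rule sum.mono_neutral_cong_right)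
    show "\<forall>u\<in>V - {v} - neighbours E v. cycle_weight M [v, u] * ?g [v, u] = 0"
      using off by (auto simp: cycle_weight_def neighbours_def insert_commute lessThan_Suc numeral_2_eq_2)
    fix u assume u: "u \<in> neighbours E v"
    then have "M u v = - \<gamma>" "M v u = - \<gamma>"
      using off[of u v] off[of v u] nb by (auto simp: neighbours_def insert_commute)
    then show "cycle_weight M [v, u] * ?g [v, u] =
        \<gamma>\<^sup>2 * (hook_immanant (V - {u, v}) (k - 2) M - hook_immanant (V - {u, v}) k M)"
      by (simp add: cycle_weight_def insert_commute lessThan_Suc numeral_2_eq_2 power2_eq_square)
  qed (use fin nb in auto)
  note two = this
  define h where "h = (\<lambda>(W::'a set, F::'a set set). \<gamma> ^ card W *
      ((-1) ^ card W * hook_immanant (V - W) (k - int (card W)) M - hook_immanant (V - W) k M))"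
  have "(\<Sum>ws | ws \<in> rooted_lists V v \<and> 3 \<le> length ws. cycle_weight M ws * ?g ws) =
      (\<Sum>ws | ws \<in> rooted_lists V v \<and> 3 \<le> length ws \<and> cycle_edges ws \<subseteq> E. h (set ws, cycle_edges ws))"
  proof (rule sum.mono_neutral_cong_right)
    have w: "cycle_weight M ws = (if cycle_edges ws \<subseteq> E then (- \<gamma>) ^ length ws else 0)"
      if "ws \<in> rooted_lists V v" "3 \<le> length ws" for ws
      using that off by (intro cycle_weight_offdiagonal) (auto simp: rooted_lists_def)
    show "\<forall>ws\<in>{ws. ws \<in> rooted_lists V v \<and> 3 \<le> length ws} -
        {ws. ws \<in> rooted_lists V v \<and> 3 \<le> length ws \<and> cycle_edges ws \<subseteq> E}. cycle_weight M ws * ?g ws = 0"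
      using w by auto
    fix ws assume "ws \<in> {ws. ws \<in> rooted_lists V v \<and> 3 \<le> length ws \<and> cycle_edges ws \<subseteq> E}"
    then have ws: "ws \<in> rooted_lists V v" "3 \<le> length ws" "cycle_edges ws \<subseteq> E" by auto
    then have "card (set ws) = length ws" by (simp add: rooted_lists_def distinct_card)
    then show "cycle_weight M ws * ?g ws = h (set ws, cycle_edges ws)"
      using w[OF ws(1,2)] ws(3) by (simp only: h_def if_True split_conv cycle_term_sign)
  qed (use finite_rooted_lists[OF fin, of v] in auto)
  also have "\<dots> = 2 * (\<Sum>C\<in>cycles_through_vertex E v. h C)"
    by (rule sum_rooted_cycles[OF G])
  finally have three: "(\<Sum>ws | ws \<in> rooted_lists V v \<and> 3 \<le> length ws. cycle_weight M ws * ?g ws) =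
      2 * (\<Sum>C\<in>cycles_through_vertex E v. h C)" .
  have "hook_immanant V k M = cycle_weight M [v] * ?g [v] + (\<Sum>u\<in>V - {v}. cycle_weight M [v, u] * ?g [v, u])
      + (\<Sum>ws | ws \<in> rooted_lists V v \<and> 3 \<le> length ws. cycle_weight M ws * ?g ws)"
    unfolding hook_immanant_expand[OF fin v, of k M] by (rule sum_rooted_lists_split[OF fin v])
  also have "cycle_weight M [v] * ?g [v] =
      (x - \<beta> * real (degree E v)) * (hook_immanant (V - {v}) (k - 1) M + hook_immanant (V - {v}) k M)"
    by (simp add: cycle_weight_def Mvv)
  finally show ?thesis
    unfolding poly two three sum_distrib_left[symmetric] by (simp add: h_def)
qed

text \<open>Between the two graphs stands the matrix \<open>N2\<close> with the diagonal of
  \<open>G\<close> and the other entries of \<open>G - uv\<close>. The steps up to it yield all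
  terms with \<open>\<beta>\<close>; the step from it to \<open>G\<close> yields those with
  \<open>\<gamma>\<close>.\<close>

lemma edge_expansion:
  assumes G: "simple_graph V E" and e: "{u, v} \<in> E"
  shows "hook_immanantal_poly V k (H_matrix \<beta> \<gamma> E) x =
        hook_immanantal_poly V k (H_matrix \<beta> \<gamma> (E - {{u, v}})) x
        - \<beta> * (hook_immanantal_poly (V - {v}) k (H_matrix \<beta> \<gamma> (E - {{u, v}})) x
               + hook_immanantal_poly (V - {v}) (k - 1) (H_matrix \<beta> \<gamma> (E - {{u, v}})) x)
        - \<beta> * (hook_immanantal_poly (V - {u}) k (H_matrix \<beta> \<gamma> (E - {{u, v}})) x
               + hook_immanantal_poly (V - {u}) (k - 1) (H_matrix \<beta> \<gamma> (E - {{u, v}})) x)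
        + ((\<beta>\<^sup>2 - \<gamma>\<^sup>2) * hook_immanantal_poly (V - {u, v}) k (H_matrix \<beta> \<gamma> E) x
           + 2 * \<beta>\<^sup>2 * hook_immanantal_poly (V - {u, v}) (k - 1) (H_matrix \<beta> \<gamma> E) x
           + (\<beta>\<^sup>2 + \<gamma>\<^sup>2) * hook_immanantal_poly (V - {u, v}) (k - 2) (H_matrix \<beta> \<gamma> E) x)
        + 2 * (\<Sum>(W, F)\<in>cycles_through_edge E {u, v}.
            \<gamma> ^ card W *
              ((-1) ^ card W * hook_immanantal_poly (V - W) (k - int (card W)) (H_matrix \<beta> \<gamma> E) x
               - hook_immanantal_poly (V - W) k (H_matrix \<beta> \<gamma> E) x))"
proof -
  let ?E = "E - {{u, v}}"
  define M where "M = (\<lambda>u v. (if u = v then x else 0) - H_matrix \<beta> \<gamma> E u v)"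
  define N where "N = (\<lambda>a b. (if a = b then x else 0) - H_matrix \<beta> \<gamma> ?E a b)"
  define N1 where "N1 = (\<lambda>a b. N a b - (if a = v \<and> b = v then \<beta> else 0))"
  define N2 where "N2 = (\<lambda>a b. N1 a b - (if a = u \<and> b = u then \<beta> else 0))"
  have polyM: "hook_immanantal_poly I j (H_matrix \<beta> \<gamma> E) x = hook_immanant I j M" for I j
    by (simp add: hook_immanantal_poly_def M_def)
  have polyN: "hook_immanantal_poly I j (H_matrix \<beta> \<gamma> ?E) x = hook_immanant I j N" for I j
    by (simp add: hook_immanantal_poly_def N_def)
  have fin: "finite V" and edge: "\<And>e. e \<in> E \<Longrightarrow> e \<subseteq> V \<and> card e = 2" using G by (auto simp: simple_graph_def)
  have uv: "u \<noteq> v" "u \<in> V" "v \<in> V" using edge[OF e] by auto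
  have nb_fin: "finite (neighbours E w)" for w
    using edge by (intro finite_subset[OF _ fin]) (auto simp: neighbours_def)
  have deg: "degree E a = degree ?E a + (if a = u \<or> a = v then 1 else 0)" for a
  proof -
    consider "a = u" | "a = v" | "a \<noteq> u" "a \<noteq> v" by blast
    then show ?thesis
    proof cases
      case 1
      have "neighbours E u = insert v (neighbours ?E u)" "v \<notin> neighbours ?E u"
        using e uv by (auto simp: neighbours_def doubleton_eq_iff insert_commute)
      then show ?thesis using 1 nb_fin[of u] by (simp add: degree_def)
    next
      case 2
      have "neighbours E v = insert u (neighbours ?E v)" "u \<notin> neighbours ?E v"
        using e uv by (auto simp: neighbours_def doubleton_eq_iff)
      then show ?thesis using 2 nb_fin[of v] by (simp add: degree_def)
    next
      case 3
      then have "neighbours E a = neighbours ?E a" by (auto simp: neighbours_def doubleton_eq_iff)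
      then show ?thesis using 3 by (simp add: degree_def)
    qed
  qed
  have loop: "{a, a} \<notin> E" for a using edge[of "{a, a}"] by auto
  have diag: "M a a = N2 a a" for a
    using loop[of a] uv deg[of a]
    by (auto simp: M_def N_def N1_def N2_def H_matrix_def degree_matrix_def adjacency_matrix_def algebra_simps)
  have offM: "M a b = (if {a, b} \<in> E then - \<gamma> else 0)" if "a \<noteq> b" for a b
    unfolding M_def using that by (rule H_matrix_offdiagonal)
  have offN: "N2 a b = (if {a, b} \<in> ?E then - \<gamma> else 0)" if "a \<noteq> b" for a b
  proof -
    have "N2 a b = N a b" using that by (auto simp: N1_def N2_def)
    then show ?thesis unfolding N_def using H_matrix_offdiagonal[OF that] by metis
  qed
  \<comment> \<open>Without \<open>v\<close>, the two entries of the edge are gone, and nothing else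
    distinguishes the matrices.\<close>
  have MN2: "hook_immanant (V - S) j N2 = hook_immanant (V - S) j M" if "v \<in> S" for S j
  proof (rule hook_immanant_cong)
    fix a b assume "a \<in> V - S" "b \<in> V - S"
    then have "{a, b} \<noteq> {u, v}" using that by (auto simp: doubleton_eq_iff)
    then show "N2 a b = M a b" using diag offM offN by (cases "a = b") auto
  qed
  have uvN: "hook_immanant (V - {u, v}) j N = hook_immanant (V - {u, v}) j M" for j
  proof -
    have "hook_immanant (V - {u, v}) j N = hook_immanant (V - {u, v}) j N2"
      by (rule hook_immanant_cong) (auto simp: N1_def N2_def)
    then show ?thesis using MN2[of "{u, v}"] by simp
  qed
  \<comment> \<open>The index set is left free because the change at \<open>v\<close> is needed on
    \<open>V\<close> and again on \<open>V - {u}\<close>; the second use produces the terms with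
    \<open>\<beta>\<^sup>2\<close>.\<close>
  have step1: "hook_immanant I j N1 = hook_immanant I j N
      - \<beta> * (hook_immanant (I - {v}) j N + hook_immanant (I - {v}) (j - 1) N)"
    if "finite I" "v \<in> I" for I j
    using that by (intro hook_immanant_diagonal_change) (auto simp: N1_def)
  have step2: "hook_immanant V k N2 = hook_immanant V k N1
      - \<beta> * (hook_immanant (V - {u}) k N1 + hook_immanant (V - {u}) (k - 1) N1)"
    using fin uv by (intro hook_immanant_diagonal_change) (auto simp: N2_def)
  have Vuv: "V - {u} - {v} = V - {u, v}" by auto
  have N2: "hook_immanant V k N2 = hook_immanant V k N
      - \<beta> * (hook_immanant (V - {v}) k N + hook_immanant (V - {v}) (k - 1) N)
      - \<beta> * (hook_immanant (V - {u}) k N + hook_immanant (V - {u}) (k - 1) N)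
      + \<beta>\<^sup>2 * (hook_immanant (V - {u, v}) k M + 2 * hook_immanant (V - {u, v}) (k - 1) M
          + hook_immanant (V - {u, v}) (k - 2) M)"
    using fin uv
    by (simp add: step2 step1 Vuv uvN power2_eq_square algebra_simps)
  let ?g = "\<lambda>ws. hook_immanant (V - set ws) (k - int (length ws)) M
     + (-1) ^ (length ws + 1) * hook_immanant (V - set ws) k M"
  have vws: "v \<in> set ws" if "ws \<in> rooted_lists V v" for ws
    using that hd_in_set[of ws] by (auto simp: rooted_lists_def)
  have N2_exp: "hook_immanant V k N2 = (\<Sum>ws\<in>rooted_lists V v. cycle_weight N2 ws * ?g ws)"
    unfolding hook_immanant_expand[OF fin uv(3), of k N2]
    by (intro sum.cong refl) (simp add: MN2 vws)
  \<comment> \<open>Every rooted list contains \<open>v\<close>, so by \<open>MN2\<close> both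
    expansions share the factor \<open>?g\<close> and only differences of weights remain.\<close>
  let ?d = "\<lambda>ws. (cycle_weight M ws - cycle_weight N2 ws) * ?g ws"
  have "hook_immanant V k M - hook_immanant V k N2 = (\<Sum>ws\<in>rooted_lists V v. ?d ws)"
    unfolding N2_exp unfolding hook_immanant_expand[OF fin uv(3), of k M]
    by (simp only: sum_subtractf[symmetric] left_diff_distrib)
  also have "\<dots> = ?d [v] + (\<Sum>w\<in>V - {v}. ?d [v, w]) + (\<Sum>ws | ws \<in> rooted_lists V v \<and> 3 \<le> length ws. ?d ws)"
    by (rule sum_rooted_lists_split[OF fin uv(3)])
  also have "?d [v] = 0" by (simp add: cycle_weight_def diag)
  also have "(\<Sum>w\<in>V - {v}. ?d [v, w]) =
      \<gamma>\<^sup>2 * (hook_immanant (V - {u, v}) (k - 2) M - hook_immanant (V - {u, v}) k M)"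
  proof -
    have "?d [v, w] = 0" if "w \<in> V - {v} - {u}" for w
      using that offM[of v w] offM[of w v] offN[of v w] offN[of w v]
      by (auto simp: cycle_weight_def numeral_2_eq_2 lessThan_Suc doubleton_eq_iff insert_commute)
    then have "(\<Sum>w\<in>V - {v}. ?d [v, w]) = (\<Sum>w\<in>{u}. ?d [v, w])"
      using fin uv by (intro sum.mono_neutral_right) auto
    moreover have "cycle_weight M [v, u] = \<gamma>\<^sup>2" "cycle_weight N2 [v, u] = 0"
      using offM[of v u] offM[of u v] offN[of v u] offN[of u v] uv e
      by (auto simp: cycle_weight_def numeral_2_eq_2 lessThan_Suc insert_commute)
    ultimately show ?thesis by (simp add: insert_commute)
  qed
  also have "(\<Sum>ws | ws \<in> rooted_lists V v \<and> 3 \<le> length ws. ?d ws) =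
      2 * (\<Sum>(W, F)\<in>cycles_through_edge E {u, v}. \<gamma> ^ card W *
         ((-1) ^ card W * hook_immanant (V - W) (k - int (card W)) M - hook_immanant (V - W) k M))"
  proof -
    define h0 where "h0 = (\<lambda>(W::'a set, F::'a set set). \<gamma> ^ card W *
         ((-1) ^ card W * hook_immanant (V - W) (k - int (card W)) M - hook_immanant (V - W) k M))"
    \<comment> \<open>Extension by zero allows the count of rooted lists at \<open>v\<close> to be
      applied; the support is cut down to cycles through the edge afterwards.\<close>
    define h where "h = (\<lambda>C. if {u, v} \<in> snd C then h0 C else 0)"
    have "(\<Sum>ws | ws \<in> rooted_lists V v \<and> 3 \<le> length ws. ?d ws) =
      (\<Sum>ws | ws \<in> rooted_lists V v \<and> 3 \<le> length ws \<and> cycle_edges ws \<subseteq> E. h (set ws, cycle_edges ws))"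
    proof (rule sum.mono_neutral_cong_right)
      have w: "cycle_weight M ws = (if cycle_edges ws \<subseteq> E then (- \<gamma>) ^ length ws else 0)"
        "cycle_weight N2 ws = (if cycle_edges ws \<subseteq> ?E then (- \<gamma>) ^ length ws else 0)"
        if "ws \<in> rooted_lists V v" "3 \<le> length ws" for ws
        using that by (intro cycle_weight_offdiagonal offM offN; simp add: rooted_lists_def)+
      show "\<forall>ws\<in>{ws. ws \<in> rooted_lists V v \<and> 3 \<le> length ws} -
          {ws. ws \<in> rooted_lists V v \<and> 3 \<le> length ws \<and> cycle_edges ws \<subseteq> E}. ?d ws = 0"
        using w by auto
      fix ws assume "ws \<in> {ws. ws \<in> rooted_lists V v \<and> 3 \<le> length ws \<and> cycle_edges ws \<subseteq> E}"
      then have ws: "ws \<in> rooted_lists V v" "3 \<le> length ws" "cycle_edges ws \<subseteq> E" by auto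
      then have card: "card (set ws) = length ws" by (simp add: rooted_lists_def distinct_card)
      \<comment> \<open>A cycle of \<open>G\<close> avoiding the edge has equal weights in both
        matrices, and one using it has weight 0 in \<open>N2\<close>.\<close>
      have "cycle_edges ws \<subseteq> ?E \<longleftrightarrow> {u, v} \<notin> cycle_edges ws" using ws(3) by blast
      then have "?d ws = (if {u, v} \<in> cycle_edges ws then (- \<gamma>) ^ length ws * ?g ws else 0)"
        using w[OF ws(1,2)] ws(3) by simp
      also have "(- \<gamma>) ^ length ws * ?g ws = h0 (set ws, cycle_edges ws)"
        by (simp only: h0_def card split_conv cycle_term_sign)
      finally show "?d ws = h (set ws, cycle_edges ws)" by (simp add: h_def)
    qed (use finite_rooted_lists[OF fin, of v] in auto)
    also have "\<dots> = 2 * (\<Sum>C\<in>cycles_through_vertex E v. h C)"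
      by (rule sum_rooted_cycles[OF G])
    also have "(\<Sum>C\<in>cycles_through_vertex E v. h C) = (\<Sum>C\<in>cycles_through_edge E {u, v}. h0 C)"
    proof (rule sum.mono_neutral_cong_right)
      have "cycles E \<subseteq> Pow V \<times> Pow (Pow V)"
      proof
        fix C assume "C \<in> cycles E"
        then obtain us where us: "C = (set us, cycle_edges us)" "distinct us" "cycle_edges us \<subseteq> E"
          by (auto simp: cycles_def)
        have "x \<in> V" if "x \<in> set us" for x
          using us(3) edge[of "{x, cycle_of_list us x}"] that by (auto simp: cycle_edges_eq_image[OF us(2)])
        moreover have "cycle_edges us \<subseteq> Pow V" using us(3) edge by blast
        ultimately show "C \<in> Pow V \<times> Pow (Pow V)" using us(1) by blast
      qed
      then have "finite (cycles E)" by (rule finite_subset) (simp add: fin)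
      then show "finite (cycles_through_vertex E v)" by (simp add: cycles_through_vertex_def)
      show "cycles_through_edge E {u, v} \<subseteq> cycles_through_vertex E v"
      proof
        fix C assume "C \<in> cycles_through_edge E {u, v}"
        then have C: "C \<in> cycles E" "{u, v} \<in> snd C" by (auto simp: cycles_through_edge_def)
        then obtain us where us: "C = (set us, cycle_edges us)" "distinct us" by (auto simp: cycles_def)
        then have "v \<in> set us"
          using C(2) permutes_in_image[OF cycle_permutes[of us]]
          by (auto simp: cycle_edges_eq_image[OF us(2)] doubleton_eq_iff)
        then show "C \<in> cycles_through_vertex E v" using us C by (simp add: cycles_through_vertex_def)
      qed
    qed (auto simp: h_def cycles_through_edge_def cycles_through_vertex_def)
    finally show ?thesis by (simp add: h0_def)
  qed
  finally have "hook_immanant V k M = hook_immanant V k N2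
      + \<gamma>\<^sup>2 * (hook_immanant (V - {u, v}) (k - 2) M - hook_immanant (V - {u, v}) k M)
      + 2 * (\<Sum>(W, F)\<in>cycles_through_edge E {u, v}. \<gamma> ^ card W *
         ((-1) ^ card W * hook_immanant (V - W) (k - int (card W)) M - hook_immanant (V - W) k M))"
    by simp
  then show ?thesis
    unfolding polyM polyN N2 by (simp add: algebra_simps)
qed

theorem theorem1p1:
  fixes V :: "'v set" and E :: "'v set set" and \<beta> \<gamma> x :: real and k :: int
  assumes "simple_graph V E"
  shows "(\<forall>v\<in>V.
      hook_immanantal_poly V k (H_matrix \<beta> \<gamma> E) x =
        (x - \<beta> * real (degree E v)) *
          (hook_immanantal_poly (V - {v}) (k - 1) (H_matrix \<beta> \<gamma> E) x
           + hook_immanantal_poly (V - {v}) k (H_matrix \<beta> \<gamma> E) x)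
        + \<gamma>\<^sup>2 * (\<Sum>u\<in>neighbours E v.
            hook_immanantal_poly (V - {u, v}) (k - 2) (H_matrix \<beta> \<gamma> E) x
            - hook_immanantal_poly (V - {u, v}) k (H_matrix \<beta> \<gamma> E) x)
        + 2 * (\<Sum>(W, F)\<in>cycles_through_vertex E v.
            \<gamma> ^ card W *
              ((-1) ^ card W * hook_immanantal_poly (V - W) (k - int (card W)) (H_matrix \<beta> \<gamma> E) x
               - hook_immanantal_poly (V - W) k (H_matrix \<beta> \<gamma> E) x)))
    \<and> (\<forall>u v. {u, v} \<in> E \<longrightarrow>
      hook_immanantal_poly V k (H_matrix \<beta> \<gamma> E) x =
        hook_immanantal_poly V k (H_matrix \<beta> \<gamma> (E - {{u, v}})) x
        - \<beta> * (hook_immanantal_poly (V - {v}) k (H_matrix \<beta> \<gamma> (E - {{u, v}})) x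
               + hook_immanantal_poly (V - {v}) (k - 1) (H_matrix \<beta> \<gamma> (E - {{u, v}})) x)
        - \<beta> * (hook_immanantal_poly (V - {u}) k (H_matrix \<beta> \<gamma> (E - {{u, v}})) x
               + hook_immanantal_poly (V - {u}) (k - 1) (H_matrix \<beta> \<gamma> (E - {{u, v}})) x)
        + ((\<beta>\<^sup>2 - \<gamma>\<^sup>2) * hook_immanantal_poly (V - {u, v}) k (H_matrix \<beta> \<gamma> E) x
           + 2 * \<beta>\<^sup>2 * hook_immanantal_poly (V - {u, v}) (k - 1) (H_matrix \<beta> \<gamma> E) x
           + (\<beta>\<^sup>2 + \<gamma>\<^sup>2) * hook_immanantal_poly (V - {u, v}) (k - 2) (H_matrix \<beta> \<gamma> E) x)
        + 2 * (\<Sum>(W, F)\<in>cycles_through_edge E {u, v}.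
            \<gamma> ^ card W *
              ((-1) ^ card W * hook_immanantal_poly (V - W) (k - int (card W)) (H_matrix \<beta> \<gamma> E) x
               - hook_immanantal_poly (V - W) k (H_matrix \<beta> \<gamma> E) x)))"
  using vertex_expansion[OF assms] edge_expansion[OF assms] by (intro conjI ballI allI impI)

end
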